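(* Let $\mathcal{A}^{s}_k$ denote the $k$-th snake cross pattern, $k\ge1$. If $\{\mathcal{A}_k\}_{k\ge1}$ is a sequence of labyrinth patterns such that, for every $k\ge1$, the core of $\mathcal{A}_k$ is $\mathcal{A}^{s}_k$, then the box counting dimension of the resulting mixed labyrinth fractal $L_\infty$ generated by $\{\mathcal{A}_k\}_{k\ge1}$ is $\dim_B(L_\infty)=2$, and every arc in $L_\infty$ that connects distinct points in this dendrite has box counting dimension $2$.
   Context: **Patterns and limit sets.** For $m\ge1$ and $0\le i,j\le m-1$ let $S_{i,j,m}=[\frac im,\frac{i+1}m]\times[\frac jm,\frac{j+1}m]$ (column $i$, row $j$) and $\mathcal{S}_m=\{S_{i,j,m}: 0\le i,j\le m-1\}$. A nonempty $\mathcal{A}\subseteq\mathcal{S}_m$ is an $m$-pattern of width $m$; its elements are called white squares. For a square $Q=[x,x+q]\times[y,y+q]\subseteq[0,1]^2$ let $P_Q(z_x,z_y)=(qz_x+x,qz_y+y)$. Given a sequence of patterns $\{\mathcal{A}_k\}_{k\ge1}$ of widths $m_k$, put $m(n)=\prod_{k=1}^n m_k$, $\mathcal{W}_1=\mathcal{A}_1$, and $\mathcal{W}_n=\{P_{W'}(W): W\in\mathcal{A}_n, W'\in\mathcal{W}_{n-1}\}\subseteq\mathcal{S}_{m(n)}$ for $n\ge2$ (white squares of level $n$); $L_n=\bigcup_{W\in\mathcal{W}_n}W$ and $L_\infty=\bigcap_{n\ge1}L_n$. **Labyrinth patterns.** The graph $\mathcal{G}(\mathcal{A})$ has the white squares of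 $\mathcal{A}$ as vertices, two being adjacent iff they share a common side. A vertical exit pair of $\mathcal{A}$ consists of two white squares in the same column, one in the top row and one in the bottom row; a horizontal exit pair consists of two white squares in the same row, one in the left and one in the right column. An $m$-pattern with $m\ge3$ is a labyrinth pattern if: (1) $\mathcal{G}(\mathcal{A})$ is a tree; (2) $\mathcal{A}$ has exactly one vertical and exactly one horizontal exit pair; (3) if a corner square of the $m\times m$ grid is white, then the diagonally opposite corner square is not white. If all $\mathcal{A}_k$ are labyrinth patterns, $L_\infty$ is called a mixed labyrinth fractal. It is known that such an $L_\infty$ is a dendrite, so any two distinct points of $L_\infty$ are connected by a unique arc in $L_\infty$. **Core.** The core of a labyrinth pattern $\mathcal{A}\subseteq\mathcal{S}_m$ is the intersection of all labyrinth patterns (of width $m$) that are subsets of $\mathcal{A}$. **Snake cross patterns.** For $k\ge1$ the $k$-th snake cross pattern $\mathcal{A}^s_k$ has width $4k+7$. Denote by $(x,y)$ (integers, $|x|,|y|\le 2k+3$) the square $S_{2k+3+x,\,2k+3+y,\,4k+7}$, so $(0,0)$ is the central square. Put $x_0=0$ and $x_j=(-1)^{j+1}(2j-1)$ for $1\le j\le k$. The top arm consists of the squares: $(0,1),(0,2)$; for each $j=1,\dots,k$, all $(x,2j)$ with $x$ between $x_{j-1}$ and $x_j$ (inclusive), and $(x_j,2j+1),(x_j,2j+2)$; all $(x,2k+2)$ with $x$ between $0$ and $x_k$ (inclusive); and $(0,2k+3)$. The white squares of $\mathcal{A}^s_k$ are the central square, the top arm, and the images of the top arm under rotation by $90^\circ,180^\circ,270^\circ$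 about the central square. *)

theory Defs
  imports "HOL-Analysis.Analysis"
begin

section \<open>Squares and patterns\<close>

text \<open>
  The square in column \<open>i\<close> and row \<open>j\<close> of the \<open>m \<times> m\<close> grid is encoded by the pair \<open>(i, j)\<close>;
  columns are counted from the left and rows from the bottom.  A pattern is a width \<open>m\<close> together
  with a set of such pairs.
\<close>

definition square :: "nat \<Rightarrow> nat \<times> nat \<Rightarrow> (real \<times> real) set" where
  "square m s = {real (fst s) / real m .. (real (fst s) + 1) / real m} \<times>
                {real (snd s) / real m .. (real (snd s) + 1) / real m}"

definition grid :: "nat \<Rightarrow> (nat \<times> nat) set" where
  "grid m = {..<m} \<times> {..<m}"

definition pattern :: "nat \<Rightarrow> (nat \<times> nat) set \<Rightarrow> bool" where
  "pattern m A \<longleftrightarrow> m \<ge> 1 \<and> A \<noteq> {} \<and> A \<subseteq> grid m"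


section \<open>Limit sets\<close>

text \<open>\<open>square_map M s\<close> is the similarity \<open>P\<^sub>Q\<close> from the unit square onto \<open>Q = square M s\<close>.\<close>

definition square_map :: "nat \<Rightarrow> nat \<times> nat \<Rightarrow> real \<times> real \<Rightarrow> real \<times> real" where
  "square_map M s z = (1 / real M * fst z + real (fst s) / real M,
                       1 / real M * snd z + real (snd s) / real M)"

text \<open>\<open>refine m t s\<close> encodes the image under \<open>P\<^sub>Q\<close> of the \<open>m\<close>-grid square \<open>s\<close>, where \<open>Q\<close> is encoded
  by \<open>t\<close>; see \<open>square_map_image_square\<close> below.\<close>

definition refine :: "nat \<Rightarrow> nat \<times> nat \<Rightarrow> nat \<times> nat \<Rightarrow> nat \<times> nat" where
  "refine m t s = (fst t * m + fst s, snd t * m + snd s)"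

lemma square_map_image_square:
  assumes "M \<ge> 1" and "m \<ge> 1"
  shows "square_map M t ` square m s = square (M * m) (refine m t s)"
proof -
  have M: "real M > 0" and m: "real m > 0" using assms by auto
  have iff: "real a / real m \<le> x \<and> x \<le> (real a + 1) / real m \<longleftrightarrow>
      real (b * m + a) / real (M * m) \<le> 1 / real M * x + real b / real M \<and>
      1 / real M * x + real b / real M \<le> (real (b * m + a) + 1) / real (M * m)"
    for a b :: nat and x :: real
  proof -
    have "1 / real M * x + real b / real M = (real b * real m + real m * x) / (real M * real m)"
      using M m by (simp add: field_simps)
    moreover have "\<not> real M * real m < 0" using M m by (simp add: not_less)
    ultimately show ?thesis
      using M m by (simp add: divide_le_cancel pos_divide_le_eq pos_le_divide_eq algebra_simps)
  qed
  have sq: "square_map M t z \<in> square (M * m) (refine m t s) \<longleftrightarrow> z \<in> square m s" for z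
    using iff[of "fst s" "fst z" "fst t"] iff[of "snd s" "snd z" "snd t"]
    by (auto simp: square_def refine_def square_map_def mem_Times_iff)
  have surj: "\<exists>z. w = square_map M t z" for w
    using M
    by (intro exI[of _ "(real M * fst w - real (fst t), real M * snd w - real (snd t))"])
      (simp add: square_map_def prod_eq_iff field_simps)
  show ?thesis
  proof (intro equalityI subsetI)
    fix w assume "w \<in> square (M * m) (refine m t s)"
    with surj[of w] sq show "w \<in> square_map M t ` square m s" by auto
  qed (use sq in auto)
qed

definition width_prod :: "(nat \<Rightarrow> nat) \<Rightarrow> nat \<Rightarrow> nat" where
  "width_prod m n = (\<Prod>k = 1..n. m k)"

text \<open>The white squares of level \<open>n\<close>, as squares of the grid of width \<open>width_prod m n\<close>.  Pattern
  sequences are indexed from 1; level 0 is the unit square, so that level 1 is \<open>A 1\<close>.\<close>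

fun white :: "(nat \<Rightarrow> nat) \<Rightarrow> (nat \<Rightarrow> (nat \<times> nat) set) \<Rightarrow> nat \<Rightarrow> (nat \<times> nat) set" where
  "white m A 0 = {(0, 0)}"
| "white m A (Suc n) = {refine (m (Suc n)) t s | t s. t \<in> white m A n \<and> s \<in> A (Suc n)}"

lemma white_1: "white m A 1 = A 1"
  by (simp add: refine_def)

definition level_set :: "(nat \<Rightarrow> nat) \<Rightarrow> (nat \<Rightarrow> (nat \<times> nat) set) \<Rightarrow> nat \<Rightarrow> (real \<times> real) set" where
  "level_set m A n = (\<Union>s \<in> white m A n. square (width_prod m n) s)"

definition limit_set :: "(nat \<Rightarrow> nat) \<Rightarrow> (nat \<Rightarrow> (nat \<times> nat) set) \<Rightarrow> (real \<times> real) set" where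
  "limit_set m A = (\<Inter>n \<in> {1..}. level_set m A n)"


section \<open>Labyrinth patterns and their cores\<close>

definition side_adjacent :: "nat \<times> nat \<Rightarrow> nat \<times> nat \<Rightarrow> bool" where
  "side_adjacent s t \<longleftrightarrow>
     fst s = fst t \<and> (snd t = snd s + 1 \<or> snd s = snd t + 1) \<or>
     snd s = snd t \<and> (fst t = fst s + 1 \<or> fst s = fst t + 1)"

definition pattern_edges :: "(nat \<times> nat) set \<Rightarrow> ((nat \<times> nat) \<times> (nat \<times> nat)) set" where
  "pattern_edges A = {(s, t). s \<in> A \<and> t \<in> A \<and> side_adjacent s t}"

text \<open>Trees are meant in the sense of undirected graphs, given here by a vertex set \<open>V\<close> and a
  symmetric irreflexive edge relation \<open>E\<close>.\<close>

definition is_cycle :: "('a \<times> 'a) set \<Rightarrow> 'a list \<Rightarrow> bool" where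
  "is_cycle E p \<longleftrightarrow> length p \<ge> 3 \<and> distinct p \<and>
     (\<forall>i < length p. (p ! i, p ! (Suc i mod length p)) \<in> E)"

definition is_tree :: "'a set \<Rightarrow> ('a \<times> 'a) set \<Rightarrow> bool" where
  "is_tree V E \<longleftrightarrow> V \<noteq> {} \<and> (\<forall>u \<in> V. \<forall>v \<in> V. (u, v) \<in> E\<^sup>*) \<and> (\<nexists>p. is_cycle E p)"

definition vertical_exit_pair :: "nat \<Rightarrow> (nat \<times> nat) set \<Rightarrow> nat \<Rightarrow> bool" where
  "vertical_exit_pair m A i \<longleftrightarrow> (i, m - 1) \<in> A \<and> (i, 0) \<in> A"

definition horizontal_exit_pair :: "nat \<Rightarrow> (nat \<times> nat) set \<Rightarrow> nat \<Rightarrow> bool" where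
  "horizontal_exit_pair m A j \<longleftrightarrow> (0, j) \<in> A \<and> (m - 1, j) \<in> A"

definition labyrinth_pattern :: "nat \<Rightarrow> (nat \<times> nat) set \<Rightarrow> bool" where
  "labyrinth_pattern m A \<longleftrightarrow>
     m \<ge> 3 \<and> pattern m A \<and>
     is_tree A (pattern_edges A) \<and>
     (\<exists>!i. vertical_exit_pair m A i) \<and>
     (\<exists>!j. horizontal_exit_pair m A j) \<and>
     \<not> ((0, 0) \<in> A \<and> (m - 1, m - 1) \<in> A) \<and>
     \<not> ((0, m - 1) \<in> A \<and> (m - 1, 0) \<in> A)"

definition core :: "nat \<Rightarrow> (nat \<times> nat) set \<Rightarrow> (nat \<times> nat) set" where
  "core m A = \<Inter> {B. labyrinth_pattern m B \<and> B \<subseteq> A}"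


section \<open>Snake cross patterns\<close>

text \<open>Arms are described in integer coordinates centred at the central square.\<close>

definition snake_turn :: "nat \<Rightarrow> int" where
  "snake_turn j = (if j = 0 then 0 else (- 1) ^ (j + 1) * (2 * int j - 1))"

definition row_segment :: "int \<Rightarrow> int \<Rightarrow> int \<Rightarrow> (int \<times> int) set" where
  "row_segment a b y = {min a b .. max a b} \<times> {y}"

definition top_arm :: "nat \<Rightarrow> (int \<times> int) set" where
  "top_arm k =
     {(0, 1), (0, 2)} \<union>
     (\<Union>j \<in> {1..k}. row_segment (snake_turn (j - 1)) (snake_turn j) (2 * int j) \<union>
        {(snake_turn j, 2 * int j + 1), (snake_turn j, 2 * int j + 2)}) \<union>
     row_segment 0 (snake_turn k) (2 * int k + 2) \<union>
     {(0, 2 * int k + 3)}"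

definition rot90 :: "int \<times> int \<Rightarrow> int \<times> int" where
  "rot90 p = (- snd p, fst p)"

definition centred_cross :: "nat \<Rightarrow> (int \<times> int) set" where
  "centred_cross k = {(0, 0)} \<union> (\<Union>r \<in> {0..3}. (rot90 ^^ r) ` top_arm k)"

definition snake_cross :: "nat \<Rightarrow> (nat \<times> nat) set" where
  "snake_cross k =
     (\<lambda>(x, y). (nat (2 * int k + 3 + x), nat (2 * int k + 3 + y))) ` centred_cross k"

text \<open>\<open>snake_cross k\<close> is to be read as a set of squares of the grid of width \<open>4 * k + 7\<close>.  A core
  equal to \<open>snake_cross k\<close> as a set of index pairs necessarily has this width, so that equality of
  index sets means equality of patterns.\<close>

lemma snake_turn_abs_le: "\<bar>snake_turn j\<bar> \<le> 2 * int j"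
proof -
  have "\<bar>(- 1 :: int) ^ (j + 1)\<bar> = 1" by (simp add: power_abs)
  then show ?thesis by (auto simp: snake_turn_def abs_mult)
qed

lemma top_arm_bound:
  assumes "p \<in> top_arm k"
  shows "\<bar>fst p\<bar> \<le> 2 * int k + 3 \<and> \<bar>snd p\<bar> \<le> 2 * int k + 3"
proof -
  have seg: "\<bar>fst p\<bar> \<le> c \<and> \<bar>snd p\<bar> = y"
    if "p \<in> row_segment a b y" "\<bar>a\<bar> \<le> c" "\<bar>b\<bar> \<le> c" "y \<ge> 0" for a b c y
    using that by (auto simp: row_segment_def)
  from assms consider "p \<in> {(0, 1), (0, 2), (0, 2 * int k + 3)}"
    | j where "j \<in> {1..k}" "p \<in> row_segment (snake_turn (j - 1)) (snake_turn j) (2 * int j)"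
    | j where "j \<in> {1..k}"
        "p \<in> {(snake_turn j, 2 * int j + 1), (snake_turn j, 2 * int j + 2)}"
    | "p \<in> row_segment 0 (snake_turn k) (2 * int k + 2)"
    unfolding top_arm_def by blast
  then show ?thesis
  proof cases
    case 1
    then show ?thesis by auto
  next
    case (2 j)
    have "\<bar>fst p\<bar> \<le> 2 * int j \<and> \<bar>snd p\<bar> = 2 * int j"
      using snake_turn_abs_le[of j] snake_turn_abs_le[of "j - 1"]
      by (intro seg[OF 2(2)]) auto
    with 2(1) show ?thesis by auto
  next
    case (3 j)
    with snake_turn_abs_le[of j] show ?thesis by auto
  next
    case 4
    have "\<bar>fst p\<bar> \<le> 2 * int k \<and> \<bar>snd p\<bar> = 2 * int k + 2"
      using snake_turn_abs_le[of k] by (intro seg[OF 4]) auto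
    then show ?thesis by auto
  qed
qed

lemma rot90_pow_bound:
  "\<bar>fst p\<bar> \<le> c \<and> \<bar>snd p\<bar> \<le> c \<Longrightarrow>
   \<bar>fst ((rot90 ^^ r) p)\<bar> \<le> c \<and> \<bar>snd ((rot90 ^^ r) p)\<bar> \<le> c"
  by (induction r) (auto simp: rot90_def)

lemma snake_cross_subset_grid: "snake_cross k \<subseteq> grid (4 * k + 7)"
proof
  fix s assume "s \<in> snake_cross k"
  then obtain p where p: "p \<in> centred_cross k"
    and s: "s = (nat (2 * int k + 3 + fst p), nat (2 * int k + 3 + snd p))"
    by (auto simp: snake_cross_def)
  have "\<bar>fst p\<bar> \<le> 2 * int k + 3 \<and> \<bar>snd p\<bar> \<le> 2 * int k + 3"
    using p rot90_pow_bound[OF top_arm_bound] by (fastforce simp: centred_cross_def)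
  then show "s \<in> grid (4 * k + 7)"
    unfolding s grid_def by auto
qed

lemma core_eq_snake_cross_imp_width:
  assumes lab: "labyrinth_pattern m A" and core: "core m A = snake_cross k"
  shows "m = 4 * k + 7"
proof -
  have m: "m \<ge> 3" and "A \<subseteq> grid m"
    using lab by (auto simp: labyrinth_pattern_def pattern_def)
  obtain i where i: "vertical_exit_pair m A i" and uniq: "\<And>i'. vertical_exit_pair m A i' \<Longrightarrow> i' = i"
    using lab unfolding labyrinth_pattern_def by blast
  have "(i, m - 1) \<in> B" if B: "labyrinth_pattern m B" "B \<subseteq> A" for B
  proof -
    obtain i' where i': "vertical_exit_pair m B i'"
      using B(1) unfolding labyrinth_pattern_def by blast
    with B(2) have "vertical_exit_pair m A i'" by (auto simp: vertical_exit_pair_def)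
    with i' uniq show ?thesis by (auto simp: vertical_exit_pair_def)
  qed
  then have "(i, m - 1) \<in> snake_cross k" unfolding core[symmetric] core_def by blast
  with snake_cross_subset_grid have "m - 1 < 4 * k + 7" by (auto simp: grid_def)
  moreover have "(2 * k + 3, 4 * k + 6) \<in> snake_cross k"
  proof -
    have "(0, 2 * int k + 3) \<in> top_arm k" by (simp add: top_arm_def)
    then have "(0, 2 * int k + 3) \<in> centred_cross k"
      unfolding centred_cross_def by (intro UnI2 UN_I[of 0]) auto
    then show ?thesis unfolding snake_cross_def by (rule rev_image_eqI) (simp add: nat_eq_iff2)
  qed
  moreover have "core m A \<subseteq> A" using lab unfolding core_def by blast
  ultimately have "4 * k + 6 < m" and "m - 1 < 4 * k + 7"
    using core \<open>A \<subseteq> grid m\<close> by (auto simp: grid_def)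
  then show ?thesis by simp
qed


section \<open>Box counting dimension\<close>

text \<open>\<open>box_number \<delta> F\<close> is the least number of sets of diameter at most \<open>\<delta>\<close> that cover \<open>F\<close>.
  Boundedness of the covering sets is required because \<^const>\<open>diameter\<close> is only meaningful for
  bounded sets.\<close>

definition box_number :: "real \<Rightarrow> (real \<times> real) set \<Rightarrow> nat" where
  "box_number \<delta> F = (LEAST n. \<exists>C. finite C \<and> card C = n \<and> F \<subseteq> \<Union> C \<and>
     (\<forall>U \<in> C. bounded U \<and> diameter U \<le> \<delta>))"

text \<open>As usual, the dimension is considered for nonempty bounded sets only, and it exists iff the
  lower and the upper limit of the quotient coincide.\<close>

definition has_box_dimension :: "(real \<times> real) set \<Rightarrow> real \<Rightarrow> bool" where
  "has_box_dimension F d \<longleftrightarrow> F \<noteq> {} \<and> bounded F \<and>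
     ((\<lambda>\<delta>. ln (real (box_number \<delta> F)) / - ln \<delta>) \<longlongrightarrow> d) (at_right 0)"

end

theory Submission
  imports Defs
begin

text \<open>
The width of the \<open>k\<close>-th pattern is \<open>4 * k + 7\<close>, while an arm of the snake cross
inside it winds through more than \<open>k\<^sup>2\<close> squares. So a connected set that runs through a
white square from one side to another is forced through a fixed positive proportion of the grid squares of the
next level, and it runs through each of these again from one side to another. After \<open>n\<close> levels it
meets at least \<open>(fact n)\<^sup>2\<close> squares, up to a constant factor, of a grid whose width is at
most \<open>11 ^ n * fact n\<close>. The factor \<open>11 ^ n\<close> is negligible, because \<open>n\<close>
is small against \<open>ln (fact n)\<close>; hence the dimension is at least 2
(\<open>box_dimension_2I\<close>), and a subset of the unit square cannot do better.

To make this precise, write the limit set as the union of its pieces, which are small copies of the limit set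
of the shifted sequence of patterns, one for each white square of the first pattern
(\<open>limit_set_decomposition\<close>). The exits of every pattern lie in the middle of its sides and
opposite corners are never both white. By self-similarity two pieces are disjoint unless their squares share a
side, and then they meet at most in the midpoint of that side (\<open>pieces_meet_at_midpoint\<close>). Since
the graph of the pattern is a tree, cutting an edge separates the limit set into two closed parts with at most
that midpoint in common. A connected subset that meets both parts therefore contains the midpoint
(\<open>connected_contains_walk_points\<close>), and for the same reason its trace on a piece is connected
again (\<open>connected_inter_piece\<close>). Hence a connected subset of the limit set that contains two of
the four side midpoints of the unit square follows the walk through the two corresponding arms of the snake
cross, and its trace on each intermediate piece, rescaled, again contains two side midpoints
(\<open>crossing_meets_many_pieces\<close>). Induction gives the factorial count
(\<open>crossing_meets_factorially_many\<close>).

An arc joins two distinct points. Zooming in, these points at last lie in different pieces; the trace on some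
piece then contains a side midpoint and another point, and zooming in further, the trace on some deep piece
contains two side midpoints (\<open>connected_two_points\<close>). This costs only a constant factor in the
count. For the whole limit set the count is immediate: every piece of the limit set is a full copy of the next
one (\<open>limit_meets_factorially_many\<close>).
\<close>

section \<open>Walks in trees\<close>

text \<open>
Removing loops: when the last step of the walk returns to a vertex that was visited before, the walk
is cut off at the first visit.
\<close>

lemma rtrancl_imp_distinct_walk:
  assumes "(u, v) \<in> E\<^sup>*"
  shows "\<exists>p. p \<noteq> [] \<and> hd p = u \<and> last p = v \<and> distinct p \<and> successively (\<lambda>x y. (x, y) \<in> E) p"
  using assms
proof (induction rule: rtrancl_induct)
  case base
  show ?case by (rule exI[of _ "[u]"]) simp
next
  case (step y z)
  then obtain p where p: "p \<noteq> []" "hd p = u" "last p = y" "distinct p"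
    "successively (\<lambda>x y. (x, y) \<in> E) p" by blast
  show ?case
  proof (cases "z \<in> set p")
    case True
    then obtain xs ys where xs: "p = xs @ z # ys" by (meson split_list)
    show ?thesis
      by (rule exI[of _ "xs @ [z]"])
        (use p xs in \<open>auto simp: successively_append_iff hd_append split: if_splits\<close>)
  next
    case False
    show ?thesis
      by (rule exI[of _ "p @ [z]"])
        (use p step.hyps False in \<open>auto simp: successively_append_iff\<close>)
  qed
qed

lemma walk_imp_rtrancl:
  assumes "successively (\<lambda>x y. (x, y) \<in> E) p" "p \<noteq> []"
  shows "(hd p, last p) \<in> E\<^sup>*"
  using assms
  by (induction p) (auto simp: successively_Cons intro: converse_rtrancl_into_rtrancl split: if_splits)

abbreviation remove_edge :: "('v \<times> 'v) set \<Rightarrow> 'v \<Rightarrow> 'v \<Rightarrow> ('v \<times> 'v) set" where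
  "remove_edge E u v \<equiv> E - {(u, v), (v, u)}"

text \<open>
A second connection between the ends of an edge would close up with that edge to a cycle; it has at
least three vertices because the edge itself is not available.
\<close>

lemma tree_edge_is_bridge:
  assumes tree: "is_tree V E" and sym: "sym E" and e: "(u, v) \<in> E" and ne: "u \<noteq> v"
  shows "(u, v) \<notin> (remove_edge E u v)\<^sup>*"
proof
  assume walk: "(u, v) \<in> (remove_edge E u v)\<^sup>*"
  obtain p where p: "p \<noteq> []" "hd p = u" "last p = v" "distinct p"
    "successively (\<lambda>x y. (x, y) \<in> remove_edge E u v) p"
    using rtrancl_imp_distinct_walk[OF walk] by blast
  have len: "length p \<ge> 3"
  proof (rule ccontr)
    assume "\<not> length p \<ge> 3"
    then have "length p = 1 \<or> length p = 2" using p(1) by (cases "length p") auto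
    then consider x where "p = [x]" | x y where "p = [x, y]"
      by (auto simp: length_Suc_conv numeral_2_eq_2)
    then show False using p ne by cases simp_all
  qed
  have "(p ! i, p ! (Suc i mod length p)) \<in> E" if "i < length p" for i
  proof (cases "Suc i < length p")
    case True
    then show ?thesis using p(5) by (simp add: successively_conv_nth)
  next
    case False
    then have "Suc i = length p" using that by simp
    then have "i = length p - 1" "Suc i mod length p = 0" by simp_all
    then have "p ! i = v" "p ! (Suc i mod length p) = u"
      using p(1-3) hd_conv_nth[OF p(1)] last_conv_nth[OF p(1)] by simp_all
    then show ?thesis using symD[OF sym e] by simp
  qed
  then have "is_cycle E p" using p(4) len by (auto simp: is_cycle_def)
  then show False using tree by (auto simp: is_tree_def)
qed


section \<open>Connected subsets of a tree of closed pieces\<close>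

text \<open>
A space is covered by closed pieces \<open>P v\<close> whose intersection pattern is a tree, and the pieces at the
ends of an edge have at most the one point \<open>q u v\<close> in common.  A connected set can
pass from one piece to another only along the edges of the tree, through these points.
\<close>

locale tree_of_pieces =
  fixes V :: "'v set" and E :: "('v \<times> 'v) set"
    and P :: "'v \<Rightarrow> 'a::topological_space set" and q :: "'v \<Rightarrow> 'v \<Rightarrow> 'a"
  assumes finite_vertices: "finite V"
    and tree: "is_tree V E"
    and sym_edges: "sym E"
    and edges_subset: "E \<subseteq> V \<times> V"
    and irrefl_edges: "irrefl E"
    and closed_piece: "v \<in> V \<Longrightarrow> closed (P v)"
    and pieces_meet: "\<lbrakk>u \<in> V; v \<in> V; u \<noteq> v; x \<in> P u; x \<in> P v\<rbrakk> \<Longrightarrow> (u, v) \<in> E \<and> x = q u v"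
begin

text \<open>
Deleting the edge between \<open>u\<close> and \<open>v\<close> splits the tree, and with it the pieces, into two parts.  The walk
shows that \<open>K\<close> meets both parts, so by connectedness it contains a point common to both, and
\<open>q u v\<close> is the only candidate.
\<close>

lemma connected_contains_walk_points:
  assumes K: "connected K" "K \<subseteq> (\<Union>v\<in>V. P v)"
    and p: "distinct (xs @ [u, v] @ ys)" "successively (\<lambda>x y. (x, y) \<in> E) (xs @ [u, v] @ ys)"
    and a: "a \<in> K" "a \<in> P (hd (xs @ [u]))" and b: "b \<in> K" "b \<in> P (last (v # ys))"
  shows "q u v \<in> K \<inter> P u \<inter> P v"
proof -
  let ?E = "remove_edge E u v"
  define U where "U = {w \<in> V. (u, w) \<in> ?E\<^sup>*}"
  have e: "(u, v) \<in> E" using p(2) by (auto simp: successively_append_iff successively_Cons)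
  have uv: "u \<noteq> v" "u \<in> V" "v \<in> V" using p(1) e edges_subset by auto
  have symE: "sym ?E" using sym_edges by (auto simp: sym_def)
  have vU: "v \<notin> U" using tree_edge_is_bridge[OF tree sym_edges e uv(1)] by (simp add: U_def)
  have "successively (\<lambda>x y. (x, y) \<in> ?E) (xs @ [u])"
    by (rule successively_mono[where P = "\<lambda>x y. (x, y) \<in> E"])
      (use p in \<open>auto simp: successively_append_iff successively_Cons\<close>)
  from walk_imp_rtrancl[OF this] have "(hd (xs @ [u]), u) \<in> ?E\<^sup>*" by simp
  then have hd_u: "(u, hd (xs @ [u])) \<in> ?E\<^sup>*" using symE by (metis sym_rtrancl symD)
  have "successively (\<lambda>x y. (x, y) \<in> ?E) (v # ys)"
    by (rule successively_mono[where P = "\<lambda>x y. (x, y) \<in> E"])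
      (use p in \<open>auto simp: successively_append_iff successively_Cons\<close>)
  from walk_imp_rtrancl[OF this] have v_last: "(v, last (v # ys)) \<in> ?E\<^sup>*" by simp
  have inV: "w \<in> V" if "(w', w) \<in> ?E\<^sup>*" "w' \<in> V" for w w'
    using that edges_subset by (induction rule: rtrancl_induct) auto
  have hdU: "hd (xs @ [u]) \<in> U" using hd_u inV uv by (auto simp: U_def)
  have lastV: "last (v # ys) \<in> V - U"
  proof -
    have "(u, last (v # ys)) \<notin> ?E\<^sup>*"
    proof
      assume "(u, last (v # ys)) \<in> ?E\<^sup>*"
      moreover have "(last (v # ys), v) \<in> ?E\<^sup>*" using v_last symE by (metis sym_rtrancl symD)
      ultimately have "(u, v) \<in> ?E\<^sup>*" by (rule rtrancl_trans)
      then show False using vU uv by (simp add: U_def)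
    qed
    then show ?thesis using inV[OF v_last uv(3)] by (simp add: U_def)
  qed
  \<comment> \<open>No edge other than the deleted one leads from one part to the other.\<close>
  have only: "w = u \<and> w' = v" if "(w, w') \<in> E" "w \<in> U" "w' \<in> V - U" for w w'
  proof (rule ccontr)
    assume n: "\<not> (w = u \<and> w' = v)"
    have "(w, w') \<noteq> (v, u)" using that vU by auto
    with n that(1) have "(w, w') \<in> ?E" by auto
    with that show False by (auto simp: U_def intro: rtrancl_into_rtrancl)
  qed
  have cl: "closed (\<Union>w\<in>U. P w)" "closed (\<Union>w\<in>V - U. P w)"
    using finite_vertices closed_piece by (auto intro!: closed_UN simp: U_def)
  have "(\<Union>w\<in>U. P w) \<inter> K \<noteq> {}" "(\<Union>w\<in>V - U. P w) \<inter> K \<noteq> {}"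
    using hdU lastV a b by blast+
  moreover have "K \<subseteq> (\<Union>w\<in>U. P w) \<union> (\<Union>w\<in>V - U. P w)" using K(2) by blast
  ultimately have "(\<Union>w\<in>U. P w) \<inter> (\<Union>w\<in>V - U. P w) \<inter> K \<noteq> {}"
    using connected_closedD[OF K(1) _ _ cl] by blast
  then obtain x w w' where x: "x \<in> K" "x \<in> P w" "x \<in> P w'" "w \<in> U" "w' \<in> V - U" by blast
  then have "(w, w') \<in> E \<and> x = q w w'" by (intro pieces_meet) (auto simp: U_def)
  with only x show ?thesis by auto
qed

text \<open>
If the trace of \<open>K\<close> on the piece of \<open>w\<close> fell apart into \<open>C\<close> and \<open>D\<close>, then so would \<open>K\<close>: every branch of
the tree at \<open>w\<close> is attached to that piece in one point only, so the whole branch can be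
added to the part that contains this point.
\<close>

lemma connected_inter_piece:
  assumes K: "connected K" "K \<subseteq> (\<Union>v\<in>V. P v)" and w: "w \<in> V"
  shows "connected (K \<inter> P w)"
proof (rule ccontr)
  assume "\<not> connected (K \<inter> P w)"
  then obtain C D where CD: "closed C" "closed D" "K \<inter> P w \<subseteq> C \<union> D"
      "C \<inter> D \<inter> (K \<inter> P w) = {}" "C \<inter> (K \<inter> P w) \<noteq> {}" "D \<inter> (K \<inter> P w) \<noteq> {}"
    unfolding connected_closed by blast
  \<comment> \<open>\<open>B\<close> collects the branches at \<open>w\<close> that are attached at a point of \<open>C\<close>; the branches whose
    point of attachment is not in \<open>K\<close> may go to either side and are added to \<open>D\<close>.\<close>
  define F where "F = {(x, y) \<in> E. x \<noteq> w \<and> y \<noteq> w}"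
  define B where "B = {x \<in> V - {w}. \<exists>n. (w, n) \<in> E \<and> q w n \<in> C \<inter> K \<inter> P w \<and> (n, x) \<in> F\<^sup>*}"
  define C' where "C' = (C \<inter> P w) \<union> (\<Union>x\<in>B. P x)"
  define D' where "D' = (D \<inter> P w) \<union> (\<Union>x\<in>V - {w} - B. P x)"
  have B_sub: "B \<subseteq> V" by (auto simp: B_def)
  have cl: "closed C'" "closed D'"
    using finite_vertices closed_piece CD(1,2) w B_sub finite_subset[OF B_sub]
    unfolding C'_def D'_def by (auto intro!: closed_Un closed_Int closed_UN)
  have cover: "K \<subseteq> C' \<union> D'"
    using K(2) CD(3) unfolding C'_def D'_def by blast
  have ne: "C' \<inter> K \<noteq> {}" "D' \<inter> K \<noteq> {}" using CD(5,6) unfolding C'_def D'_def by blast+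
  have False if z: "z \<in> C'" "z \<in> D'" "z \<in> K" for z
  proof -
    consider "z \<in> C" "z \<in> D" "z \<in> P w"
      | x where "z \<in> C" "z \<in> P w" "x \<in> V - {w} - B" "z \<in> P x"
      | x where "z \<in> D" "z \<in> P w" "x \<in> B" "z \<in> P x"
      | x y where "x \<in> B" "z \<in> P x" "y \<in> V - {w} - B" "z \<in> P y"
      using z unfolding C'_def D'_def by blast
    then show False
    proof cases
      case 1
      then show ?thesis using CD(4) z by blast
    next
      case (2 x)
      then have "(w, x) \<in> E \<and> z = q w x" using w by (intro pieces_meet) auto
      then have "x \<in> B" using 2 z unfolding B_def by blast
      then show ?thesis using 2 by blast
    next
      \<comment> \<open>This case would give two branches at \<open>w\<close>, through \<open>n\<close> and through \<open>x\<close>, that are joined away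
        from \<open>w\<close>, which is impossible in a tree.\<close>
      case (3 x)
      then have wx: "(w, x) \<in> E" "z = q w x" "x \<noteq> w"
        using pieces_meet[of w x z] w B_sub by (auto simp: B_def)
      obtain n where n: "(w, n) \<in> E" "q w n \<in> C \<inter> K \<inter> P w" "(n, x) \<in> F\<^sup>*"
        using 3 by (auto simp: B_def)
      have "n \<noteq> x" using n wx 3 z CD(4) by blast
      then have "(w, n) \<in> remove_edge E w x" using n irrefl_edges by (auto simp: irrefl_def)
      moreover have "(n, x) \<in> (remove_edge E w x)\<^sup>*"
        using n(3) rtrancl_mono[of F "remove_edge E w x"] by (auto simp: F_def)
      ultimately have "(w, x) \<in> (remove_edge E w x)\<^sup>*" by (rule converse_rtrancl_into_rtrancl)
      then show ?thesis using tree_edge_is_bridge[OF tree sym_edges wx(1)] wx(3) by blast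
    next
      case (4 x y)
      then have "x \<noteq> w" "x \<in> V" by (auto simp: B_def)
      then have "(x, y) \<in> F" using 4 pieces_meet[of x y z] by (auto simp: F_def)
      then have "y \<in> B" using 4 unfolding B_def by (auto intro: rtrancl_into_rtrancl)
      then show ?thesis using 4 by blast
    qed
  qed
  then have "C' \<inter> D' \<inter> K = {}" by blast
  from connected_closedD[OF K(1) this cover cl] ne show False by blast
qed

end

section \<open>Self-similar decomposition of the limit set\<close>

lemma mem_square_iff:
  "z \<in> square m s \<longleftrightarrow>
     real (fst s) / real m \<le> fst z \<and> fst z \<le> (real (fst s) + 1) / real m \<and>
     real (snd s) / real m \<le> snd z \<and> snd z \<le> (real (snd s) + 1) / real m"
  by (auto simp: square_def mem_Times_iff)

lemma mem_unit_square_iff: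
  "z \<in> square 1 (0, 0) \<longleftrightarrow> 0 \<le> fst z \<and> fst z \<le> 1 \<and> 0 \<le> snd z \<and> snd z \<le> 1"
  by (simp add: mem_square_iff)

lemma closed_square: "closed (square m s)"
  unfolding square_def by (intro closed_Times closed_real_atLeastAtMost)

lemma square_map_eq: "square_map M s z = (1 / real M) *\<^sub>R z + (real (fst s) / real M, real (snd s) / real M)"
  by (simp add: square_map_def prod_eq_iff)

lemma square_map_inj: "M \<ge> 1 \<Longrightarrow> square_map M s z = square_map M s w \<longleftrightarrow> z = w"
  by (auto simp: square_map_eq)

lemma dist_square_map: "dist (square_map M s z) (square_map M s w) = dist z w / real M"
  by (simp add: square_map_eq dist_norm flip: scaleR_diff_right)

lemma closed_square_map_image: "closed S \<Longrightarrow> closed (square_map M s ` S)"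
proof -
  assume "closed S"
  then have "closed ((+) (real (fst s) / real M, real (snd s) / real M) ` ((*\<^sub>R) (1 / real M) ` S))"
    by (intro closed_translation closed_scaling)
  moreover have "square_map M s ` S =
      (+) (real (fst s) / real M, real (snd s) / real M) ` ((*\<^sub>R) (1 / real M) ` S)"
    unfolding image_image by (rule image_cong) (simp_all add: square_map_eq add.commute)
  ultimately show ?thesis by simp
qed

lemma width_prod_Suc_front: "width_prod m (Suc n) = m 1 * width_prod (m \<circ> Suc) n"
proof -
  have "width_prod m (Suc n) = m 1 * (\<Prod>k = Suc 1..Suc n. m k)"
    unfolding width_prod_def by (subst prod.atLeast_Suc_atMost) auto
  also have "(\<Prod>k = Suc 1..Suc n. m k) = width_prod (m \<circ> Suc) n"
    unfolding width_prod_def by (subst prod.shift_bounds_cl_Suc_ivl) simp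
  finally show ?thesis .
qed

lemma width_prod_ge_1: "(\<And>k. k \<ge> 1 \<Longrightarrow> m k \<ge> 1) \<Longrightarrow> width_prod m n \<ge> 1"
  unfolding width_prod_def by (intro prod_ge_1) auto

text \<open>
The recursion for \<open>white\<close> refines the last level.  Self-similarity of the limit set needs the other
end of the sequence: the first pattern followed by the white squares of the shifted sequence.
\<close>

lemma white_Suc_front:
  "white m A (Suc n) =
     {refine (width_prod (m \<circ> Suc) n) s t | s t. s \<in> A 1 \<and> t \<in> white (m \<circ> Suc) (A \<circ> Suc) n}"
proof (induction n)
  case 0
  show ?case by (auto simp: refine_def width_prod_def)
next
  case (Suc n)
  let ?w = "width_prod (m \<circ> Suc) n" and ?k = "Suc (Suc n)"
  have assoc: "refine (m ?k) (refine ?w s t) u = refine (?w * m ?k) s (refine (m ?k) t u)" for s t u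
    by (simp add: refine_def algebra_simps)
  have w: "width_prod (m \<circ> Suc) (Suc n) = ?w * m ?k"
    by (simp add: width_prod_def)
  have "white m A ?k = {refine (m ?k) (refine ?w s t) u | s t u.
      s \<in> A 1 \<and> t \<in> white (m \<circ> Suc) (A \<circ> Suc) n \<and> u \<in> A ?k}"
    by (subst white.simps, subst Suc.IH) blast
  also have "\<dots> = {refine (?w * m ?k) s v | s v. s \<in> A 1 \<and> v \<in> white (m \<circ> Suc) (A \<circ> Suc) (Suc n)}"
    unfolding assoc by (simp only: white.simps o_def) blast
  finally show ?case by (simp only: w)
qed

locale widths_and_patterns =
  fixes m :: "nat \<Rightarrow> nat" and A :: "nat \<Rightarrow> (nat \<times> nat) set"
  assumes patterns: "k \<ge> 1 \<Longrightarrow> pattern (m k) (A k)"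
begin

lemma shift: "widths_and_patterns (m \<circ> Suc) (A \<circ> Suc)"
  by unfold_locales (simp add: patterns)

lemma width_ge_1: "k \<ge> 1 \<Longrightarrow> m k \<ge> 1"
  using patterns by (auto simp: pattern_def)

lemma finite_pattern: "k \<ge> 1 \<Longrightarrow> finite (A k)"
  using patterns[of k] finite_subset[of "A k" "grid (m k)"] by (simp add: pattern_def grid_def)

lemma level_set_Suc_front:
  "level_set m A (Suc n) = (\<Union>s\<in>A 1. square_map (m 1) s ` level_set (m \<circ> Suc) (A \<circ> Suc) n)"
proof -
  have "width_prod (m \<circ> Suc) n \<ge> 1" by (rule width_prod_ge_1) (simp only: o_def, rule width_ge_1, simp)
  then have sq: "square_map (m 1) s ` square (width_prod (m \<circ> Suc) n) t =
      square (width_prod m (Suc n)) (refine (width_prod (m \<circ> Suc) n) s t)" for s t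
    using width_ge_1[of 1] by (subst square_map_image_square) (simp_all add: width_prod_Suc_front)
  have "level_set m A (Suc n) = (\<Union>s\<in>A 1. \<Union>t\<in>white (m \<circ> Suc) (A \<circ> Suc) n.
      square (width_prod m (Suc n)) (refine (width_prod (m \<circ> Suc) n) s t))"
    unfolding level_set_def white_Suc_front by blast
  then show ?thesis by (simp only: level_set_def image_UN sq)
qed

lemma level_set_1_subset: "level_set m A 1 \<subseteq> square 1 (0, 0)"
proof
  fix z assume "z \<in> level_set m A 1"
  then obtain s where s: "s \<in> A 1" "z \<in> square (m 1) s"
    unfolding level_set_def white_1 by (auto simp: width_prod_def)
  then have lt: "fst s < m 1" "snd s < m 1" using patterns[of 1] by (auto simp: pattern_def grid_def)
  then have "(real (fst s) + 1) / real (m 1) \<le> 1" "(real (snd s) + 1) / real (m 1) \<le> 1"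
    by (simp_all add: field_simps)
  moreover have "0 \<le> real (fst s) / real (m 1)" "0 \<le> real (snd s) / real (m 1)" by simp_all
  ultimately show "z \<in> square 1 (0, 0)"
    using s(2) mem_square_iff[of z "m 1" s] unfolding mem_unit_square_iff by linarith
qed

end

lemma level_set_Suc_subset:
  assumes "widths_and_patterns m A"
  shows "level_set m A (Suc n) \<subseteq> level_set m A n"
  using assms
proof (induction n arbitrary: m A)
  case 0
  have "level_set m A 0 = square 1 (0, 0)" by (simp add: level_set_def width_prod_def)
  then show ?case using widths_and_patterns.level_set_1_subset[OF 0] by simp
next
  case (Suc n)
  then interpret widths_and_patterns m A by simp
  show ?case using Suc.IH[OF shift] by (subst (1 2) level_set_Suc_front) blast
qed

context widths_and_patterns
begin

lemma level_set_antimono: "i \<le> j \<Longrightarrow> level_set m A j \<subseteq> level_set m A i"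
  using level_set_Suc_subset[OF widths_and_patterns_axioms] by (rule lift_Suc_antimono_le)

lemma limit_set_eq_all_levels: "limit_set m A = (\<Inter>n. level_set m A n)"
proof (intro equalityI INT_greatest)
  fix n
  have "limit_set m A \<subseteq> level_set m A (max 1 n)" unfolding limit_set_def by (rule INT_lower) simp
  also have "\<dots> \<subseteq> level_set m A n" by (rule level_set_antimono) simp
  finally show "limit_set m A \<subseteq> level_set m A n" .
qed (auto simp: limit_set_def)

lemma limit_set_subset_unit_square: "limit_set m A \<subseteq> square 1 (0, 0)"
  using level_set_1_subset unfolding limit_set_def by blast

lemma finite_white: "finite (white m A n)"
proof (induction n)
  case (Suc n)
  have "white m A (Suc n) = (\<lambda>(t, s). refine (m (Suc n)) t s) ` (white m A n \<times> A (Suc n))"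
    by auto
  with Suc show ?case by (simp add: finite_pattern)
qed simp

lemma closed_limit_set: "closed (limit_set m A)"
  unfolding limit_set_def level_set_def by (intro closed_INT ballI closed_UN closed_square finite_white)

text \<open>
A point of the limit set lies, for every \<open>n\<close>, in the level \<open>n\<close> part of some white square of the first
level.  These parts decrease with \<open>n\<close> and there are finitely many squares, so one square serves for
all \<open>n\<close>.
\<close>

lemma limit_set_decomposition:
  "limit_set m A = (\<Union>s\<in>A 1. square_map (m 1) s ` limit_set (m \<circ> Suc) (A \<circ> Suc))"
proof (intro equalityI subsetI)
  interpret tail: widths_and_patterns "m \<circ> Suc" "A \<circ> Suc" by (rule shift)
  let ?L = "\<lambda>s n. square_map (m 1) s ` level_set (m \<circ> Suc) (A \<circ> Suc) n"
  fix x assume x: "x \<in> limit_set m A"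
  have "\<exists>s\<in>A 1. \<forall>n. x \<in> ?L s n"
  proof (rule ccontr)
    assume "\<not> ?thesis"
    then obtain n where n: "\<And>s. s \<in> A 1 \<Longrightarrow> x \<notin> ?L s (n s)" by metis
    define N where "N = Max (n ` A 1)"
    have "n s \<le> N" if "s \<in> A 1" for s using that finite_pattern[of 1] by (simp add: N_def)
    then have "x \<notin> ?L s N" if "s \<in> A 1" for s
      using that n tail.level_set_antimono by blast
    then have "x \<notin> level_set m A (Suc N)" by (simp add: level_set_Suc_front)
    then show False using x by (auto simp: limit_set_eq_all_levels)
  qed
  then obtain s where s: "s \<in> A 1" "\<And>n. x \<in> ?L s n" by blast
  from s(2)[of 0] obtain z where z: "x = square_map (m 1) s z" by blast
  have "z \<in> level_set (m \<circ> Suc) (A \<circ> Suc) n" for n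
    using s(2)[of n] square_map_inj[OF width_ge_1[of 1], of s z] unfolding z image_iff by auto
  then have "z \<in> limit_set (m \<circ> Suc) (A \<circ> Suc)" by (simp add: tail.limit_set_eq_all_levels)
  then show "x \<in> (\<Union>s\<in>A 1. square_map (m 1) s ` limit_set (m \<circ> Suc) (A \<circ> Suc))"
    using s(1) z by blast
next
  interpret tail: widths_and_patterns "m \<circ> Suc" "A \<circ> Suc" by (rule shift)
  fix x assume "x \<in> (\<Union>s\<in>A 1. square_map (m 1) s ` limit_set (m \<circ> Suc) (A \<circ> Suc))"
  then have x: "x \<in> level_set m A (Suc n)" for n
    unfolding level_set_Suc_front tail.limit_set_eq_all_levels by blast
  have "x \<in> level_set m A n" if "n \<ge> 1" for n
    using that x[of "n - 1"] by simp
  then show "x \<in> limit_set m A" unfolding limit_set_def by simp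
qed

end

section \<open>Walks through a snake cross\<close>

text \<open>
The walks are built in the integer coordinates of the snake cross, where rotations are linear.
\<close>

definition int_adjacent :: "int \<times> int \<Rightarrow> int \<times> int \<Rightarrow> bool" where
  "int_adjacent p q \<longleftrightarrow> \<bar>fst p - fst q\<bar> + \<bar>snd p - snd q\<bar> = 1"

definition row_walk :: "int \<Rightarrow> int \<Rightarrow> int \<Rightarrow> (int \<times> int) list" where
  "row_walk a b y = map (\<lambda>i. (a + sgn (b - a) * int i, y)) [0..<Suc (nat \<bar>b - a\<bar>)]"

lemma length_row_walk: "length (row_walk a b y) = Suc (nat \<bar>b - a\<bar>)"
  by (simp add: row_walk_def)

lemma row_walk_nonempty [simp]: "row_walk a b y \<noteq> []"
  by (simp add: row_walk_def)

lemma hd_row_walk [simp]: "hd (row_walk a b y) = (a, y)"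
  by (simp add: row_walk_def hd_map del: upt_Suc)

lemma last_row_walk [simp]: "last (row_walk a b y) = (b, y)"
  by (simp add: row_walk_def last_map sgn_if)

lemma set_row_walk: "set (row_walk a b y) \<subseteq> row_segment a b y"
  by (auto simp: row_walk_def row_segment_def sgn_if simp del: upt_Suc)

lemma distinct_row_walk: "distinct (row_walk a b y)"
  by (auto simp: row_walk_def distinct_map inj_on_def sgn_if simp del: upt_Suc)

lemma successively_row_walk: "successively int_adjacent (row_walk a b y)"
  by (auto simp: successively_conv_nth row_walk_def int_adjacent_def sgn_if simp del: upt_Suc)

lemma snake_turn_Suc_abs: "\<bar>snake_turn (Suc j)\<bar> = 2 * int j + 1"
  by (simp add: snake_turn_def abs_mult power_abs)

lemma snake_turn_step: "\<bar>snake_turn (Suc j) - snake_turn j\<bar> \<ge> 2 * int j"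
proof (cases j)
  case (Suc i)
  have "snake_turn (Suc j) - snake_turn j = (- 1) ^ (i + 1) * (4 * int j)"
    by (simp add: snake_turn_def Suc algebra_simps)
  moreover have "\<bar>(- 1 :: int) ^ (i + 1)\<bar> = 1" by (simp add: power_abs)
  ultimately have "\<bar>snake_turn (Suc j) - snake_turn j\<bar> = 4 * int j" by (simp only: abs_mult)
  then show ?thesis by simp
qed simp

text \<open>
The walk along the top arm from the square above the centre to \<open>(snake_turn j, 2 * j + 1)\<close>, that is,
through the first \<open>j\<close> turns.
\<close>

fun stem_walk :: "nat \<Rightarrow> (int \<times> int) list" where
  "stem_walk 0 = [(0, 1)]"
| "stem_walk (Suc j) = stem_walk j @ row_walk (snake_turn j) (snake_turn (Suc j)) (2 * int j + 2) @
     [(snake_turn (Suc j), 2 * int j + 3)]"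

definition arm_walk :: "nat \<Rightarrow> (int \<times> int) list" where
  "arm_walk k = stem_walk k @ row_walk (snake_turn k) 0 (2 * int k + 2) @ [(0, 2 * int k + 3)]"

lemma stem_walk_nonempty [simp]: "stem_walk j \<noteq> []"
  by (cases j) auto

lemma hd_stem_walk [simp]: "hd (stem_walk j) = (0, 1)"
  by (induction j) auto

lemma last_stem_walk [simp]: "last (stem_walk j) = (snake_turn j, 2 * int j + 1)"
  by (cases j) (auto simp: snake_turn_def)

lemma row_segment_bound:
  assumes "p \<in> row_segment a b y" "\<bar>a\<bar> \<le> c" "\<bar>b\<bar> \<le> c"
  shows "snd p = y \<and> \<bar>fst p\<bar> \<le> c"
  using assms by (auto simp: row_segment_def)

text \<open>
The arm stays inside the open wedge \<open>\<bar>x\<bar> < y\<close>.  The four rotations of this wedge are disjoint, which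
is why a walk through two different arms visits no square twice.
\<close>

lemma stem_walk_wedge:
  assumes "p \<in> set (stem_walk j)"
  shows "\<bar>fst p\<bar> < snd p \<and> snd p \<le> 2 * int j + 1"
  using assms
proof (induction j)
  case (Suc j)
  consider "p \<in> set (stem_walk j)"
    | "p \<in> row_segment (snake_turn j) (snake_turn (Suc j)) (2 * int j + 2)"
    | "p = (snake_turn (Suc j), 2 * int j + 3)"
    using Suc.prems set_row_walk by fastforce
  then show ?case
  proof cases
    case 2
    then have "snd p = 2 * int j + 2 \<and> \<bar>fst p\<bar> \<le> 2 * int j + 1"
      by (rule row_segment_bound) (use snake_turn_abs_le[of j] snake_turn_Suc_abs[of j] in auto)
    then show ?thesis by simp
  qed (use Suc.IH snake_turn_Suc_abs[of j] in auto)
qed simp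

lemma arm_walk_cases:
  assumes "p \<in> set (arm_walk k)"
  obtains "p \<in> set (stem_walk k)"
    | "p \<in> row_segment 0 (snake_turn k) (2 * int k + 2)"
    | "p = (0, 2 * int k + 3)"
proof -
  have "row_segment (snake_turn k) 0 (2 * int k + 2) = row_segment 0 (snake_turn k) (2 * int k + 2)"
    by (simp add: row_segment_def min.commute max.commute)
  then show ?thesis
    using assms that set_row_walk[of "snake_turn k" 0 "2 * int k + 2"] by (auto simp: arm_walk_def)
qed

lemma arm_walk_wedge:
  assumes "p \<in> set (arm_walk k)"
  shows "\<bar>fst p\<bar> < snd p"
  using assms
proof (cases rule: arm_walk_cases)
  case 2
  then have "snd p = 2 * int k + 2 \<and> \<bar>fst p\<bar> \<le> 2 * int k"
    by (rule row_segment_bound) (use snake_turn_abs_le[of k] in auto)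
  then show ?thesis by simp
qed (use stem_walk_wedge in auto)

lemma stem_walk_subset_top_arm: "j \<le> k \<Longrightarrow> set (stem_walk j) \<subseteq> top_arm k"
proof (induction j)
  case 0
  then show ?case by (auto simp: top_arm_def)
next
  case (Suc j)
  let ?R = "row_segment (snake_turn j) (snake_turn (Suc j)) (2 * int j + 2) \<union>
      {(snake_turn (Suc j), 2 * int j + 3)}"
  have j: "Suc j \<in> {1..k}" using Suc.prems by simp
  have "?R \<subseteq> row_segment (snake_turn (Suc j - 1)) (snake_turn (Suc j)) (2 * int (Suc j)) \<union>
      {(snake_turn (Suc j), 2 * int (Suc j) + 1), (snake_turn (Suc j), 2 * int (Suc j) + 2)}"
    by (auto simp: algebra_simps)
  then have "?R \<subseteq> top_arm k" unfolding top_arm_def using j by blast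
  moreover have "set (stem_walk j) \<subseteq> top_arm k" using Suc by simp
  ultimately show ?case
    using set_row_walk[of "snake_turn j" "snake_turn (Suc j)" "2 * int j + 2"] by auto
qed

lemma arm_walk_subset_top_arm: "set (arm_walk k) \<subseteq> top_arm k"
proof
  fix p assume "p \<in> set (arm_walk k)"
  then show "p \<in> top_arm k"
  proof (cases rule: arm_walk_cases)
    case 1
    then show ?thesis using stem_walk_subset_top_arm[of k k] by blast
  qed (auto simp: top_arm_def)
qed

lemma distinct_stem_walk: "distinct (stem_walk j)"
proof (induction j)
  case (Suc j)
  have "snd p = 2 * int j + 2" if "p \<in> set (row_walk (snake_turn j) (snake_turn (Suc j)) (2 * int j + 2))" for p
    using that by (auto simp: row_walk_def)
  with Suc show ?case using stem_walk_wedge[of _ j] by (fastforce simp: distinct_row_walk)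
qed simp

lemma successively_stem_walk: "successively int_adjacent (stem_walk j)"
proof (induction j)
  case (Suc j)
  then show ?case
    by (simp add: successively_append_iff successively_row_walk) (simp add: int_adjacent_def)
qed simp

lemma distinct_arm_walk: "distinct (arm_walk k)"
proof -
  have "snd p = 2 * int k + 2" if "p \<in> set (row_walk (snake_turn k) 0 (2 * int k + 2))" for p
    using that by (auto simp: row_walk_def)
  then show ?thesis using stem_walk_wedge[of _ k]
    by (fastforce simp: arm_walk_def distinct_row_walk distinct_stem_walk)
qed

lemma successively_arm_walk: "successively int_adjacent (arm_walk k)"
  by (simp add: arm_walk_def successively_append_iff successively_row_walk successively_stem_walk)
    (simp add: int_adjacent_def)

lemma hd_arm_walk [simp]: "hd (arm_walk k) = (0, 1)"
  by (simp add: arm_walk_def)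

lemma last_arm_walk [simp]: "last (arm_walk k) = (0, 2 * int k + 3)"
  by (simp add: arm_walk_def)

lemma arm_walk_nonempty [simp]: "arm_walk k \<noteq> []"
  by (simp add: arm_walk_def)

text \<open>
The row traversed in step \<open>j\<close> has at least \<open>2 * j + 1\<close> squares, and consecutive odd numbers sum up to
squares.
\<close>

lemma length_stem_walk: "length (stem_walk j) \<ge> j\<^sup>2 + 1"
proof (induction j)
  case (Suc j)
  have "2 * j \<le> nat \<bar>snake_turn (Suc j) - snake_turn j\<bar>" using snake_turn_step[of j] by linarith
  with Suc show ?case by (simp add: length_row_walk power2_eq_square)
qed simp

lemma length_arm_walk: "length (arm_walk k) \<ge> k\<^sup>2 + 2"
  using length_stem_walk[of k] by (simp add: arm_walk_def)

lemma int_adjacent_rot90_pow: "int_adjacent ((rot90 ^^ r) p) ((rot90 ^^ r) q) \<longleftrightarrow> int_adjacent p q"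
proof (induction r)
  case (Suc r)
  have "int_adjacent (rot90 p) (rot90 q) \<longleftrightarrow> int_adjacent p q" for p q
    unfolding int_adjacent_def rot90_def by (simp, linarith)
  with Suc show ?case by simp
qed simp

lemma rot90_pow_less_4:
  "r < 4 \<Longrightarrow> (rot90 ^^ r) p =
     [(fst p, snd p), (- snd p, fst p), (- fst p, - snd p), (snd p, - fst p)] ! r"
  by (auto simp: less_Suc_eq eval_nat_numeral rot90_def)

lemma rotated_wedges_disjoint:
  assumes "\<bar>fst p\<bar> < snd p" "\<bar>fst q\<bar> < snd q" "r < 4" "s < 4" "r \<noteq> s"
  shows "(rot90 ^^ r) p \<noteq> (rot90 ^^ s) q"
  using assms by (auto simp: rot90_pow_less_4 less_Suc_eq eval_nat_numeral)

lemma inj_rot90_pow: "inj (rot90 ^^ r)"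
proof -
  have "inj rot90" by (auto simp: inj_def rot90_def prod_eq_iff)
  then show ?thesis by (induction r) (auto intro: inj_compose)
qed

definition cross_walk :: "nat \<Rightarrow> nat \<Rightarrow> nat \<Rightarrow> (int \<times> int) list" where
  "cross_walk k r s = rev (map (rot90 ^^ r) (arm_walk k)) @ [(0, 0)] @ map (rot90 ^^ s) (arm_walk k)"

lemma cross_walk_subset:
  assumes "r < 4" "s < 4"
  shows "set (cross_walk k r s) \<subseteq> centred_cross k"
proof -
  have "(rot90 ^^ r) ` set (arm_walk k) \<subseteq> centred_cross k" if "r < 4" for r
    using that arm_walk_subset_top_arm unfolding centred_cross_def by fastforce
  from this[OF assms(1)] this[OF assms(2)] show ?thesis
    by (auto simp: cross_walk_def centred_cross_def)
qed

lemma distinct_cross_walk: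
  assumes "r < 4" "s < 4" "r \<noteq> s"
  shows "distinct (cross_walk k r s)"
proof -
  have d: "distinct (map (rot90 ^^ r) (arm_walk k))" for r
    by (simp add: distinct_map distinct_arm_walk inj_on_subset[OF inj_rot90_pow])
  have "(rot90 ^^ r) p \<noteq> (0, 0)" if "r < 4" "p \<in> set (arm_walk k)" for r p
    using that arm_walk_wedge[of p k] by (auto simp: rot90_pow_less_4 less_Suc_eq eval_nat_numeral)
  then have "(0, 0) \<notin> (rot90 ^^ r) ` set (arm_walk k)" if "r < 4" for r using that by fastforce
  moreover have "(rot90 ^^ r) ` set (arm_walk k) \<inter> (rot90 ^^ s) ` set (arm_walk k) = {}"
    using rotated_wedges_disjoint[OF arm_walk_wedge arm_walk_wedge assms] by blast
  ultimately show ?thesis using assms d unfolding cross_walk_def by auto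
qed

lemma successively_cross_walk:
  assumes "r < 4" "s < 4"
  shows "successively int_adjacent (cross_walk k r s)"
proof -
  have sym: "int_adjacent x y \<longleftrightarrow> int_adjacent y x" for x y
    by (auto simp: int_adjacent_def abs_minus_commute)
  have "successively int_adjacent (map (rot90 ^^ r) (arm_walk k))" for r
    by (simp add: successively_map int_adjacent_rot90_pow successively_arm_walk)
  moreover have "int_adjacent (0, 0) ((rot90 ^^ r) (0, 1))" if "r < 4" for r
    using that by (auto simp: rot90_pow_less_4 less_Suc_eq eval_nat_numeral int_adjacent_def)
  ultimately show ?thesis using assms sym
    by (simp add: cross_walk_def successively_append_iff successively_Cons hd_map last_rev)
qed

text \<open>
The exits of the grid of width \<open>2 * c + 1\<close> in the order top, left, bottom, right, so that the index
counts the quarter turns of the top arm.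
\<close>

definition exit_square :: "nat \<Rightarrow> nat \<Rightarrow> nat \<times> nat" where
  "exit_square c r = [(c, 2 * c), (0, c), (c, 0), (2 * c, c)] ! r"

lemma snake_cross_walk:
  assumes "r < 4" "s < 4" "r \<noteq> s"
  obtains p where "distinct p" "successively side_adjacent p" "set p \<subseteq> snake_cross k"
    "hd p = exit_square (2 * k + 3) r" "last p = exit_square (2 * k + 3) s" "length p \<ge> k\<^sup>2 + 2"
proof
  let ?g = "\<lambda>(x, y). (nat (2 * int k + 3 + x), nat (2 * int k + 3 + y))"
  let ?p = "map ?g (cross_walk k r s)"
  have bound: "\<bar>fst p\<bar> \<le> 2 * int k + 3 \<and> \<bar>snd p\<bar> \<le> 2 * int k + 3" if "p \<in> centred_cross k" for p
    using that rot90_pow_bound[OF top_arm_bound] by (fastforce simp: centred_cross_def)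
  have inj: "inj_on ?g (centred_cross k)"
  proof (rule inj_onI)
    fix p q assume "p \<in> centred_cross k" "q \<in> centred_cross k" "?g p = ?g q"
    then show "p = q" using bound[of p] bound[of q] by (auto simp: prod_eq_iff split_beta)
  qed
  note sub = cross_walk_subset[OF assms(1,2), of k]
  show "distinct ?p"
    using distinct_cross_walk[OF assms] inj_on_subset[OF inj sub] by (simp add: distinct_map)
  show "set ?p \<subseteq> snake_cross k" using sub by (auto simp: snake_cross_def)
  have "side_adjacent (?g p) (?g q)" if pq: "p \<in> centred_cross k" "q \<in> centred_cross k" "int_adjacent p q" for p q
  proof -
    have "fst p = fst q \<and> (snd q = snd p + 1 \<or> snd p = snd q + 1) \<or>
        snd p = snd q \<and> (fst q = fst p + 1 \<or> fst p = fst q + 1)"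
      using pq(3) unfolding int_adjacent_def by arith
    then show ?thesis
      using bound[OF pq(1)] bound[OF pq(2)]
      by (elim disjE conjE) (auto simp: side_adjacent_def split_beta nat_add_distrib abs_le_iff)
  qed
  then show "successively side_adjacent ?p"
    unfolding successively_map
    by (intro successively_mono[OF successively_cross_walk[OF assms(1,2)]]) (use sub in blast)+
  have e: "?g ((rot90 ^^ r) (0, 2 * int k + 3)) = exit_square (2 * k + 3) r" if "r < 4" for r
    using that by (auto simp: exit_square_def rot90_pow_less_4 less_Suc_eq eval_nat_numeral)
  show "hd ?p = exit_square (2 * k + 3) r" "last ?p = exit_square (2 * k + 3) s"
    using e[OF assms(1)] e[OF assms(2)] by (simp_all add: cross_walk_def hd_map last_map hd_rev hd_append)
  show "length ?p \<ge> k\<^sup>2 + 2" using length_arm_walk[of k] by (simp add: cross_walk_def)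
qed

section \<open>How the pieces of the limit set meet\<close>

text \<open>
Arguments about vertical and horizontal neighbours differ only in the roles of the two coordinates.
Selecting a coordinate by a truth value lets one proof cover both: \<open>\<not> b\<close> is the other coordinate.
\<close>

definition coord :: "bool \<Rightarrow> 'a \<times> 'a \<Rightarrow> 'a" where
  "coord b z = (if b then fst z else snd z)"

lemma coord_eqI: "(\<And>b. coord b z = coord b w) \<Longrightarrow> z = w"
  by (metis coord_def prod_eqI)

lemma coord_square_map: "coord b (square_map M s z) = (real (coord b s) + coord b z) / real M"
  by (simp add: coord_def square_map_def add_divide_distrib)

text \<open>
The offset \<open>j\<close> makes this class of sequences closed under dropping the first pattern, as needed for
inductions along the self-similar decomposition.
\<close>

locale snake_sequence =
  fixes j :: nat and m :: "nat \<Rightarrow> nat" and A :: "nat \<Rightarrow> (nat \<times> nat) set"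
  assumes labyrinth: "k \<ge> 1 \<Longrightarrow> labyrinth_pattern (m k) (A k)"
    and core_eq: "k \<ge> 1 \<Longrightarrow> core (m k) (A k) = snake_cross (j + k)"
begin

lemma shift: "snake_sequence (Suc j) (m \<circ> Suc) (A \<circ> Suc)"
  by unfold_locales (simp_all add: labyrinth core_eq)

sublocale widths_and_patterns m A
  by unfold_locales (use labyrinth in \<open>auto simp: labyrinth_pattern_def\<close>)

sublocale tail: widths_and_patterns "m \<circ> Suc" "A \<circ> Suc"
  by (rule widths_and_patterns.shift) unfold_locales

abbreviation limit :: "(real \<times> real) set" where
  "limit \<equiv> limit_set m A"

abbreviation tail_limit :: "(real \<times> real) set" where
  "tail_limit \<equiv> limit_set (m \<circ> Suc) (A \<circ> Suc)"

abbreviation centre :: nat where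
  "centre \<equiv> 2 * (j + 1) + 3"

lemma width: "m 1 = 2 * centre + 1"
  using core_eq_snake_cross_imp_width[OF labyrinth[of 1] core_eq[of 1]] by simp

lemma width_Suc_0: "m (Suc 0) = 2 * centre + 1"
  using width by simp

lemma snake_subset: "snake_cross (j + 1) \<subseteq> A 1"
  using labyrinth[of 1] core_eq[of 1] unfolding core_def by auto

lemma pattern_subset_grid: "A 1 \<subseteq> grid (m 1)"
  using patterns[of 1] by (simp add: pattern_def)

lemma coord_less_width: "s \<in> A 1 \<Longrightarrow> coord b s < m 1"
  using pattern_subset_grid by (auto simp: coord_def grid_def)

lemma exit_square_in_pattern: "r < 4 \<Longrightarrow> exit_square centre r \<in> A 1"
proof -
  assume "r < 4"
  have "\<exists>s::nat. s < 4 \<and> r \<noteq> s" by (rule exI[of _ "if r = 0 then 1 else 0"]) simp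
  then obtain s :: nat where s: "s < 4" "r \<noteq> s" by blast
  obtain p where "distinct p" "successively side_adjacent p"
    and p: "set p \<subseteq> snake_cross (j + 1)" "hd p = exit_square centre r"
    and "last p = exit_square centre s" and len: "length p \<ge> (j + 1)\<^sup>2 + 2"
    by (rule snake_cross_walk[OF \<open>r < 4\<close> s, of "j + 1"])
  from len have "p \<noteq> []" by auto
  with p have "exit_square centre r \<in> set p" by (metis hd_in_set)
  with p(1) snake_subset show ?thesis by blast
qed

text \<open>
The snake cross already provides a central exit pair in both directions, and a labyrinth pattern
has no other.
\<close>

lemma exit_only_at_centre:
  assumes s: "s \<in> A 1" "coord b s = 0" and t: "t \<in> A 1" "coord b t = 2 * centre"
    and eq: "coord (\<not> b) s = coord (\<not> b) t"
  shows "coord (\<not> b) s = centre"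
proof (cases b)
  case False
  have "\<exists>!i. vertical_exit_pair (m 1) (A 1) i" using labyrinth[of 1] by (simp add: labyrinth_pattern_def)
  moreover have "vertical_exit_pair (m 1) (A 1) centre"
    using exit_square_in_pattern[of 0] exit_square_in_pattern[of 2]
    by (simp add: vertical_exit_pair_def width_Suc_0 exit_square_def)
  moreover have "vertical_exit_pair (m 1) (A 1) (fst s)"
    using s t eq False by (cases s; cases t) (auto simp: vertical_exit_pair_def width_Suc_0 coord_def)
  ultimately show ?thesis using False by (auto simp: coord_def)
next
  case True
  have "\<exists>!i. horizontal_exit_pair (m 1) (A 1) i" using labyrinth[of 1] by (simp add: labyrinth_pattern_def)
  moreover have "horizontal_exit_pair (m 1) (A 1) centre"
    using exit_square_in_pattern[of 1] exit_square_in_pattern[of 3]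
    by (simp add: horizontal_exit_pair_def width_Suc_0 exit_square_def)
  moreover have "horizontal_exit_pair (m 1) (A 1) (snd s)"
    using s t eq True by (cases s; cases t) (auto simp: horizontal_exit_pair_def width_Suc_0 coord_def)
  ultimately show ?thesis using True by (auto simp: coord_def)
qed

lemma limit_coord_bounds: "z \<in> limit \<Longrightarrow> 0 \<le> coord b z \<and> coord b z \<le> 1"
  using subsetD[OF limit_set_subset_unit_square] mem_unit_square_iff[of z] by (auto simp: coord_def)

lemma tail_limit_coord_bounds: "z \<in> tail_limit \<Longrightarrow> 0 \<le> coord b z \<and> coord b z \<le> 1"
  using subsetD[OF tail.limit_set_subset_unit_square] mem_unit_square_iff[of z] by (auto simp: coord_def)

text \<open>
The last two clauses hold because a point on a side of the unit square can only come from a child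
square along that side.
\<close>

lemma limit_child:
  assumes "z \<in> limit"
  obtains s w where "s \<in> A 1" "w \<in> tail_limit" "z = square_map (m 1) s w"
    "\<And>b. real (m 1) * coord b z = real (coord b s) + coord b w"
    "\<And>b. coord b z = 0 \<Longrightarrow> coord b s = 0 \<and> coord b w = 0"
    "\<And>b. coord b z = 1 \<Longrightarrow> coord b s = 2 * centre \<and> coord b w = 1"
proof -
  obtain s w where s: "s \<in> A 1" "w \<in> tail_limit" "z = square_map (m 1) s w"
    using assms limit_set_decomposition by auto
  have eq: "real (m 1) * coord b z = real (coord b s) + coord b w" for b
    by (simp add: s(3) coord_square_map width_Suc_0)
  have "coord b s = 0 \<and> coord b w = 0" if "coord b z = 0" for b
    using eq[of b] that tail_limit_coord_bounds[OF s(2), of b] by auto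
  moreover have "coord b s = 2 * centre \<and> coord b w = 1" if "coord b z = 1" for b
  proof -
    have le: "real (coord b s) \<le> real (2 * centre)"
      using coord_less_width[OF s(1), of b] by (simp only: width of_nat_le_iff)
    have w: "coord b w \<le> 1" using tail_limit_coord_bounds[OF s(2), of b] by simp
    have sum: "real (coord b s) + coord b w = real (2 * centre) + 1"
      using eq[of b] that by (simp add: width_Suc_0)
    from le w sum have "real (coord b s) = real (2 * centre)" "coord b w = 1" by linarith+
    then show ?thesis by (simp only: of_nat_eq_iff)
  qed
  ultimately show ?thesis using that s eq by blast
qed

text \<open>
A corner of the unit square belongs to the limit set only if the corner square of the first pattern
is white.
\<close>

lemma no_opposite_corners:
  assumes z: "z \<in> limit" and z': "z' \<in> limit"
    and opp: "\<And>b. coord b z = 0 \<and> coord b z' = 1 \<or> coord b z = 1 \<and> coord b z' = 0"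
  shows False
proof -
  from limit_child[OF z] obtain s where s: "s \<in> A 1"
    "\<And>b. coord b z = 0 \<Longrightarrow> coord b s = 0" "\<And>b. coord b z = 1 \<Longrightarrow> coord b s = 2 * centre"
    by metis
  from limit_child[OF z'] obtain t where t: "t \<in> A 1"
    "\<And>b. coord b z' = 0 \<Longrightarrow> coord b t = 0" "\<And>b. coord b z' = 1 \<Longrightarrow> coord b t = 2 * centre"
    by metis
  have st: "coord b s = 0 \<and> coord b t = m 1 - 1 \<or> coord b s = m 1 - 1 \<and> coord b t = 0" for b
    using opp[of b] s(2,3)[of b] t(2,3)[of b] by (auto simp: width_Suc_0)
  have lab: "\<not> ((0, 0) \<in> A 1 \<and> (m 1 - 1, m 1 - 1) \<in> A 1)"
    "\<not> ((0, m 1 - 1) \<in> A 1 \<and> (m 1 - 1, 0) \<in> A 1)"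
    using labyrinth[of 1] by (simp_all add: labyrinth_pattern_def)
  have "s = (coord True s, coord False s)" "t = (coord True t, coord False t)"
    by (simp_all add: coord_def)
  then show False using st[of True] st[of False] s(1) t(1) lab by metis
qed

end

text \<open>
If two points on opposite sides of the unit square face each other, then so do the points of the
child squares from which they come.  These children lie in the same line: otherwise both points would
be corners of their children, and diagonally opposite ones.  So the children are the central exit pair, and passing to
them magnifies the distance from the midpoint by the width of the pattern.  This can be repeated
forever, but distances inside the unit square stay bounded.
\<close>

lemma opposite_sides_coord_approx:
  assumes "snake_sequence j m A"
    and "z \<in> limit_set m A" "coord b z = 0" "z' \<in> limit_set m A" "coord b z' = 1"
    and "coord (\<not> b) z = coord (\<not> b) z'"
  shows "\<bar>coord (\<not> b) z - 1 / 2\<bar> \<le> (1 / 3) ^ n"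
  using assms
proof (induction n arbitrary: j m A z z')
  case 0
  then interpret snake_sequence j m A by simp
  show ?case using limit_coord_bounds[OF 0(2), of "\<not> b"] by (auto simp: abs_le_iff)
next
  case (Suc n)
  then interpret snake_sequence j m A by simp
  interpret tl: snake_sequence "Suc j" "m \<circ> Suc" "A \<circ> Suc" by (rule shift)
  obtain s w where s: "s \<in> A 1" "w \<in> tail_limit"
    "\<And>b. real (m 1) * coord b z = real (coord b s) + coord b w"
    "coord b s = 0" "coord b w = 0"
    using limit_child[OF Suc.prems(2)] Suc.prems(3) by metis
  obtain t v where t: "t \<in> A 1" "v \<in> tail_limit"
    "\<And>b. real (m 1) * coord b z' = real (coord b t) + coord b v"
    "coord b t = 2 * centre" "coord b v = 1"
    using limit_child[OF Suc.prems(4)] Suc.prems(5) by metis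
  have eq: "real (coord (\<not> b) s) + coord (\<not> b) w = real (coord (\<not> b) t) + coord (\<not> b) v"
    using s(3)[of "\<not> b"] t(3)[of "\<not> b"] Suc.prems(6) by simp
  have bw: "0 \<le> coord (\<not> b) w" "coord (\<not> b) w \<le> 1" "0 \<le> coord (\<not> b) v" "coord (\<not> b) v \<le> 1"
    using tail_limit_coord_bounds[OF s(2)] tail_limit_coord_bounds[OF t(2)] by blast+
  consider "coord (\<not> b) s = coord (\<not> b) t"
    | "coord (\<not> b) w = 0 \<and> coord (\<not> b) v = 1" | "coord (\<not> b) w = 1 \<and> coord (\<not> b) v = 0"
    using eq bw by linarith
  then show ?case
  proof cases
    case 1
    have c: "coord (\<not> b) s = centre"
      by (rule exit_only_at_centre[OF s(1,4) t(1,4) 1])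
    have "coord (\<not> b) w = coord (\<not> b) v" using eq 1 by simp
    then have IH: "\<bar>coord (\<not> b) w - 1 / 2\<bar> \<le> (1 / 3) ^ n"
      using Suc.IH[OF shift s(2,5) t(2,5)] by simp
    have "real (m 1) * (coord (\<not> b) z - 1 / 2) = coord (\<not> b) w - 1 / 2"
      using s(3)[of "\<not> b"] c by (simp add: width_Suc_0 algebra_simps)
    then have "real (m 1) * \<bar>coord (\<not> b) z - 1 / 2\<bar> \<le> (1 / 3) ^ n"
      using IH by (metis abs_mult abs_of_nat)
    moreover have "3 * \<bar>coord (\<not> b) z - 1 / 2\<bar> \<le> real (m 1) * \<bar>coord (\<not> b) z - 1 / 2\<bar>"
      by (intro mult_right_mono) (simp_all add: width_Suc_0)
    ultimately show ?thesis by simp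
  next
    case 2
    have "coord b' w = 0 \<and> coord b' v = 1 \<or> coord b' w = 1 \<and> coord b' v = 0" for b'
      using 2 s(5) t(5) by (cases "b' = b") auto
    then show ?thesis using tl.no_opposite_corners[OF s(2) t(2)] by blast
  next
    case 3
    have "coord b' w = 0 \<and> coord b' v = 1 \<or> coord b' w = 1 \<and> coord b' v = 0" for b'
      using 3 s(5) t(5) by (cases "b' = b") auto
    then show ?thesis using tl.no_opposite_corners[OF s(2) t(2)] by blast
  qed
qed

text \<open>
The only point in which two copies of the limit set glued along a side can meet is the midpoint of that
side.
\<close>

lemma (in snake_sequence) opposite_sides_coord:
  assumes "z \<in> limit" "coord b z = 0" "z' \<in> limit" "coord b z' = 1" "coord (\<not> b) z = coord (\<not> b) z'"
  shows "coord (\<not> b) z = 1 / 2"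
proof -
  have "(\<lambda>n. (1 / 3 :: real) ^ n) \<longlonglongrightarrow> 0" by (rule LIMSEQ_power_zero) simp
  then have "\<bar>coord (\<not> b) z - 1 / 2\<bar> \<le> 0"
    using opposite_sides_coord_approx[OF snake_sequence_axioms assms]
    by (intro LIMSEQ_le_const) auto
  then show ?thesis by simp
qed

text \<open>
For squares with a common side the midpoint of this side is the average of their centres, a formula
that is symmetric and the same for all four directions.
\<close>

definition common_side_midpoint :: "nat \<Rightarrow> nat \<times> nat \<Rightarrow> nat \<times> nat \<Rightarrow> real \<times> real" where
  "common_side_midpoint M s t =
     (real (fst s + fst t + 1) / real (2 * M), real (snd s + snd t + 1) / real (2 * M))"

lemma common_side_midpoint_commute: "common_side_midpoint M s t = common_side_midpoint M t s"
  by (simp add: common_side_midpoint_def add_ac)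

lemma coord_common_side_midpoint:
  "coord b (common_side_midpoint M s t) = real (coord b s + coord b t + 1) / real (2 * M)"
  by (simp add: common_side_midpoint_def coord_def)

context snake_sequence
begin

abbreviation piece :: "nat \<times> nat \<Rightarrow> (real \<times> real) set" where
  "piece s \<equiv> square_map (m 1) s ` tail_limit"

text \<open>
A common point has two preimages in the unit square whose coordinates agree up to the integer
displacement of the squares.  Displacement in both directions would give diagonally opposite corners;
displacement in one direction gives points facing each other on opposite sides.
\<close>

lemma pieces_meet_at_midpoint:
  assumes s: "s \<in> A 1" and t: "t \<in> A 1" and ne: "s \<noteq> t" and x: "x \<in> piece s" "x \<in> piece t"
  shows "side_adjacent s t \<and> x = common_side_midpoint (m 1) s t"
proof -
  interpret tl: snake_sequence "Suc j" "m \<circ> Suc" "A \<circ> Suc" by (rule shift)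
  obtain w v where w: "w \<in> tail_limit" "x = square_map (m 1) s w"
    and v: "v \<in> tail_limit" "x = square_map (m 1) t v" using x by blast
  have M: "real (m 1) > 0" by (simp add: width_Suc_0)
  have xc: "coord b x = (real (coord b s) + coord b w) / real (m 1)"
    "coord b x = (real (coord b t) + coord b v) / real (m 1)" for b
    using w(2) v(2) coord_square_map by metis+
  then have eq: "real (coord b s) + coord b w = real (coord b t) + coord b v" for b
    using M by (metis divide_cancel_right less_numeral_extra(3))
  have bw: "0 \<le> coord b w" "coord b w \<le> 1" "0 \<le> coord b v" "coord b v \<le> 1" for b
    using tail_limit_coord_bounds[OF w(1)] tail_limit_coord_bounds[OF v(1)] by blast+
  have tri: "coord b s = coord b t \<or>
      coord b s = coord b t + 1 \<and> coord b w = 0 \<and> coord b v = 1 \<or>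
      coord b t = coord b s + 1 \<and> coord b w = 1 \<and> coord b v = 0" for b
    using eq[of b] bw[of b] by linarith
  obtain b where b: "coord b s \<noteq> coord b t" using ne coord_eqI by metis
  have same: "coord (\<not> b) s = coord (\<not> b) t"
  proof (rule ccontr)
    assume n: "coord (\<not> b) s \<noteq> coord (\<not> b) t"
    have "coord b' w = 0 \<and> coord b' v = 1 \<or> coord b' w = 1 \<and> coord b' v = 0" for b'
      using tri[of b'] b n by (cases "b' = b") auto
    then show False using tl.no_opposite_corners[OF w(1) v(1)] by blast
  qed
  have wv: "coord (\<not> b) w = coord (\<not> b) v" using eq[of "\<not> b"] same by simp
  have half: "coord (\<not> b) w = 1 / 2"
    using tri[of b] b tl.opposite_sides_coord[OF w(1) _ v(1) _ wv]
      tl.opposite_sides_coord[OF v(1) _ w(1) _ wv[symmetric]] wv by auto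
  have "coord b' x = coord b' (common_side_midpoint (m 1) s t)" for b'
  proof (cases "b' = b")
    case True
    then show ?thesis using tri[of b] b M xc[of b]
      by (auto simp: coord_common_side_midpoint field_simps)
  next
    case False
    then have "b' = (\<not> b)" by auto
    then show ?thesis using same half M xc(1)[of "\<not> b"]
      by (simp add: coord_common_side_midpoint field_simps)
  qed
  then have "x = common_side_midpoint (m 1) s t" by (rule coord_eqI)
  moreover have "side_adjacent s t"
    using tri[of b] b same by (cases b) (auto simp: side_adjacent_def coord_def)
  ultimately show ?thesis by blast
qed

sublocale pieces: tree_of_pieces "A 1" "pattern_edges (A 1)" piece "common_side_midpoint (m 1)"
proof
  show "finite (A 1)" by (rule finite_pattern) simp
  show "is_tree (A 1) (pattern_edges (A 1))" using labyrinth[of 1] by (simp add: labyrinth_pattern_def)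
  show "sym (pattern_edges (A 1))" by (auto simp: sym_def pattern_edges_def side_adjacent_def)
  show "pattern_edges (A 1) \<subseteq> A 1 \<times> A 1" by (auto simp: pattern_edges_def)
  show "irrefl (pattern_edges (A 1))" by (auto simp: irrefl_def pattern_edges_def side_adjacent_def)
  show "closed (piece s)" for s by (intro closed_square_map_image tail.closed_limit_set)
  show "(s, t) \<in> pattern_edges (A 1) \<and> x = common_side_midpoint (m 1) s t"
    if "s \<in> A 1" "t \<in> A 1" "s \<noteq> t" "x \<in> piece s" "x \<in> piece t" for s t x
    using pieces_meet_at_midpoint[OF that] that by (simp add: pattern_edges_def)
qed

end

section \<open>Connected sets crossing pieces\<close>

definition side_midpoint :: "nat \<Rightarrow> real \<times> real" where
  "side_midpoint r = [(1 / 2, 1), (0, 1 / 2), (1 / 2, 0), (1, 1 / 2)] ! r"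

definition side_midpoints :: "(real \<times> real) set" where
  "side_midpoints = side_midpoint ` {..<4}"

lemma side_midpoints_iff:
  "p \<in> side_midpoints \<longleftrightarrow> (\<exists>b. coord b p \<in> {0, 1} \<and> coord (\<not> b) p = 1 / 2)"
proof -
  have "{..<4::nat} = {0, 1, 2, 3}" by auto
  then have "side_midpoints = {(1 / 2, 1), (0, 1 / 2), (1 / 2, 0), (1, 1 / 2)}"
    unfolding side_midpoints_def by (simp only: image_insert image_empty) (simp add: side_midpoint_def)
  then show ?thesis
    by (cases p)
      (simp only: ex_bool_eq coord_def if_True if_False not_True_eq_False not_False_eq_True
        fst_conv snd_conv insert_iff empty_iff prod.inject, blast)
qed

text \<open>
The sides of the unit square can be entered only through their midpoints, so this expresses that a
connected subset of the limit set runs through the unit square from one side to another.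
\<close>

definition crosses_square :: "(real \<times> real) set \<Rightarrow> bool" where
  "crosses_square K \<longleftrightarrow> (\<exists>p \<in> side_midpoints. \<exists>q \<in> side_midpoints. p \<noteq> q \<and> p \<in> K \<and> q \<in> K)"

context snake_sequence
begin

text \<open>
The trace on a piece, rescaled to a subset of the limit set of the shifted sequence.
\<close>

definition zoom :: "nat \<times> nat \<Rightarrow> (real \<times> real) set \<Rightarrow> (real \<times> real) set" where
  "zoom s K = {w \<in> tail_limit. square_map (m 1) s w \<in> K}"

lemma zoom_subset: "zoom s K \<subseteq> tail_limit"
  by (auto simp: zoom_def)

lemma connected_zoom:
  assumes "connected K" "K \<subseteq> limit" "s \<in> A 1"
  shows "connected (zoom s K)"
proof -
  let ?d = "(real (fst s) / real (m 1), real (snd s) / real (m 1))"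
  let ?g = "\<lambda>x. real (m 1) *\<^sub>R (x - ?d)"
  have inv: "?g (square_map (m 1) s w) = w" for w
    using width by (simp add: square_map_eq)
  have "zoom s K = ?g ` (K \<inter> piece s)"
  proof (intro equalityI subsetI)
    fix w assume "w \<in> zoom s K"
    then show "w \<in> ?g ` (K \<inter> piece s)"
      by (intro image_eqI[of _ _ "square_map (m 1) s w"]) (simp only: inv, simp add: zoom_def)
  next
    fix w assume "w \<in> ?g ` (K \<inter> piece s)"
    then obtain v where v: "square_map (m 1) s v \<in> K" "v \<in> tail_limit" "w = ?g (square_map (m 1) s v)"
      by blast
    then show "w \<in> zoom s K" by (simp only: inv zoom_def) simp
  qed
  moreover have "connected (K \<inter> piece s)"
    using assms limit_set_decomposition by (intro pieces.connected_inter_piece) auto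
  then have "connected (?g ` (K \<inter> piece s))"
    by (intro connected_continuous_image continuous_intros)
  ultimately show ?thesis by simp
qed

lemma coord_of_image:
  "x = square_map (m 1) s w \<Longrightarrow> real (m 1) * coord b x = real (coord b s) + coord b w"
  by (simp add: coord_square_map width_Suc_0)

text \<open>
The side midpoints lie in the exit squares only, and since the width is odd they are fixed points of
the corresponding similarities.
\<close>

lemma side_midpoint_in_piece:
  assumes r: "r < 4" and w: "w \<in> tail_limit" and s: "s \<in> A 1"
    and eq: "side_midpoint r = square_map (m 1) s w"
  shows "s = exit_square centre r \<and> w = side_midpoint r"
proof -
  have "real (coord b s) = real (coord b (exit_square centre r)) \<and> coord b w = coord b (side_midpoint r)" for b
  proof -
    have x: "real (m 1) * coord b (side_midpoint r) = real (coord b s) + coord b w"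
      by (rule coord_of_image[OF eq])
    have w01: "0 \<le> coord b w" "coord b w \<le> 1" using tail_limit_coord_bounds[OF w] by blast+
    have le: "coord b s \<le> 2 * centre" using coord_less_width[OF s, of b] width by simp
    have "coord b (side_midpoint r) = 0 \<and> coord b (exit_square centre r) = 0 \<or>
        coord b (side_midpoint r) = 1 \<and> coord b (exit_square centre r) = 2 * centre \<or>
        coord b (side_midpoint r) = 1 / 2 \<and> coord b (exit_square centre r) = centre"
      using r by (auto simp: less_Suc_eq eval_nat_numeral side_midpoint_def exit_square_def coord_def)
    then show ?thesis
    proof (elim disjE conjE)
      assume a: "coord b (side_midpoint r) = 0" "coord b (exit_square centre r) = 0"
      then show ?thesis using x w01 by simp
    next
      assume a: "coord b (side_midpoint r) = 1" "coord b (exit_square centre r) = 2 * centre"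
      have "real (coord b s) \<le> real (2 * centre)" using le by (simp only: of_nat_le_iff)
      moreover have "real (2 * centre) + 1 = real (coord b s) + coord b w" using x a by (simp add: width_Suc_0)
      ultimately show ?thesis using w01 a by linarith
    next
      assume a: "coord b (side_midpoint r) = 1 / 2" "coord b (exit_square centre r) = centre"
      have e: "real centre + 1 / 2 = real (coord b s) + coord b w" using x a by (simp add: width_Suc_0)
      have "coord b s = centre" using e w01 by linarith
      then show ?thesis using e a by simp
    qed
  qed
  then show ?thesis by (metis coord_eqI of_nat_eq_iff)
qed

lemma common_side_midpoint_in_piece:
  assumes st: "side_adjacent s t" and eq: "common_side_midpoint (m 1) s t = square_map (m 1) s w"
  shows "w \<in> side_midpoints"
proof -
  have M: "real (m 1) > 0" by (simp add: width_Suc_0)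
  have w: "coord b w = (1 + real (coord b t) - real (coord b s)) / 2" for b
  proof -
    have "real (m 1) * coord b (common_side_midpoint (m 1) s t) = real (coord b s + coord b t + 1) / 2"
      using M by (simp add: coord_common_side_midpoint)
    then show ?thesis using coord_of_image[OF eq, of b] by simp
  qed
  obtain b where "coord (\<not> b) s = coord (\<not> b) t"
    "coord b t = coord b s + 1 \<or> coord b s = coord b t + 1"
  proof (cases "fst s = fst t")
    case True
    then show ?thesis using st that[of False] by (auto simp: side_adjacent_def coord_def)
  next
    case False
    then show ?thesis using st that[of True] by (auto simp: side_adjacent_def coord_def)
  qed
  then show ?thesis unfolding side_midpoints_iff by (intro exI[of _ b]) (auto simp: w)
qed

lemma common_side_midpoint_inject:
  assumes "common_side_midpoint (m 1) s t = common_side_midpoint (m 1) s t'"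
  shows "t = t'"
proof (rule coord_eqI)
  fix b
  have "coord b (common_side_midpoint (m 1) s t) = coord b (common_side_midpoint (m 1) s t')"
    using assms by simp
  then show "coord b t = coord b t'"
    by (simp add: coord_common_side_midpoint width_Suc_0)
qed

lemma common_side_midpoint_not_side_midpoint:
  assumes "s \<in> A 1" "t \<in> A 1"
  shows "common_side_midpoint (m 1) s t \<notin> side_midpoints"
proof
  assume "common_side_midpoint (m 1) s t \<in> side_midpoints"
  then obtain b where b: "coord b (common_side_midpoint (m 1) s t) \<in> {0, 1}"
    by (auto simp: side_midpoints_iff)
  have "coord b s < m 1" "coord b t < m 1" using assms coord_less_width by blast+
  then have "coord b s + coord b t + 1 < 2 * m 1" by linarith
  then have "real (coord b s + coord b t + 1) < real (2 * m 1)" by (simp only: of_nat_less_iff)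
  then show False using b by (simp add: coord_common_side_midpoint)
qed

lemma side_midpoint_fixed_by_exit_piece:
  assumes p: "p \<in> side_midpoints" "p \<in> limit"
  obtains s where "s \<in> A 1" "p \<in> piece s" "p \<in> tail_limit" "square_map (m 1) s p = p"
proof -
  obtain s w where s: "s \<in> A 1" "w \<in> tail_limit" "p = square_map (m 1) s w"
    using p limit_set_decomposition by auto
  obtain r where r: "r < 4" "p = side_midpoint r" using p(1) by (auto simp: side_midpoints_def)
  have "side_midpoint r = square_map (m 1) s w" using s(3) r(2) by simp
  then have "w = p" using side_midpoint_in_piece[OF r(1) s(2,1)] r(2) by blast
  then have "p \<in> tail_limit" "square_map (m 1) s p = p" using s(2) s(3)[symmetric] by simp_all
  then show ?thesis using that[OF s(1)] by (metis image_eqI)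
qed

lemma common_side_midpoint_in_zoom:
  assumes "common_side_midpoint (m 1) s t \<in> K \<inter> piece s" "side_adjacent s t"
  obtains w where "w \<in> zoom s K" "w \<in> side_midpoints" "square_map (m 1) s w = common_side_midpoint (m 1) s t"
proof -
  obtain w where w: "w \<in> tail_limit" "common_side_midpoint (m 1) s t = square_map (m 1) s w"
    using assms by blast
  then show ?thesis
    using that[of w] assms common_side_midpoint_in_piece[OF assms(2) w(2)] by (auto simp: zoom_def)
qed

lemma crosses_zoom:
  assumes "common_side_midpoint (m 1) s t \<in> K \<inter> piece s" "side_adjacent s t"
    and "common_side_midpoint (m 1) s t' \<in> K \<inter> piece s" "side_adjacent s t'" and "t \<noteq> t'"
  shows "crosses_square (zoom s K)"
proof -
  obtain w where w: "w \<in> zoom s K" "w \<in> side_midpoints"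
    "square_map (m 1) s w = common_side_midpoint (m 1) s t"
    by (rule common_side_midpoint_in_zoom[OF assms(1,2)])
  obtain w' where w': "w' \<in> zoom s K" "w' \<in> side_midpoints"
    "square_map (m 1) s w' = common_side_midpoint (m 1) s t'"
    by (rule common_side_midpoint_in_zoom[OF assms(3,4)])
  have "w \<noteq> w'" using w(3) w'(3) assms(5) common_side_midpoint_inject by metis
  then show ?thesis using w w' unfolding crosses_square_def by blast
qed

text \<open>
The set follows the walk through the two arms between its side midpoints.  In every intermediate square
it contains the midpoints of the sides to the predecessor and to the successor; the two end squares
of the walk are not counted.
\<close>

lemma crossing_meets_many_pieces:
  assumes K: "connected K" "K \<subseteq> limit" and cr: "crosses_square K"
  shows "\<exists>T\<subseteq>A 1. card T = (j + 1)\<^sup>2 \<and> (\<forall>s\<in>T. crosses_square (zoom s K))"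
proof -
  obtain p q where pq: "p \<in> side_midpoints" "q \<in> side_midpoints" "p \<noteq> q" "p \<in> K" "q \<in> K"
    using cr by (auto simp: crosses_square_def)
  then obtain r r' where r: "r < 4" "p = side_midpoint r" "r' < 4" "q = side_midpoint r'" "r \<noteq> r'"
    by (auto simp: side_midpoints_def)
  have start: "p \<in> piece (exit_square centre r)"
  proof -
    obtain s w where "s \<in> A 1" "w \<in> tail_limit" "p = square_map (m 1) s w"
      using pq(4) K(2) limit_set_decomposition by auto
    then show ?thesis using side_midpoint_in_piece[of r w s] r by auto
  qed
  have finish: "q \<in> piece (exit_square centre r')"
  proof -
    obtain s w where "s \<in> A 1" "w \<in> tail_limit" "q = square_map (m 1) s w"
      using pq(5) K(2) limit_set_decomposition by auto
    then show ?thesis using side_midpoint_in_piece[of r' w s] r by auto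
  qed
  obtain l where l: "distinct l" "successively side_adjacent l" "set l \<subseteq> snake_cross (j + 1)"
    "hd l = exit_square centre r" "last l = exit_square centre r'" "length l \<ge> (j + 1)\<^sup>2 + 2"
    by (rule snake_cross_walk[OF r(1,3,5), of "j + 1"])
  have walk: "successively (\<lambda>x y. (x, y) \<in> pattern_edges (A 1)) l"
    by (rule successively_mono[OF l(2)])
      (use l(3) snake_subset in \<open>auto simp: pattern_edges_def\<close>)
  have cover: "K \<subseteq> (\<Union>s\<in>A 1. piece s)" using K(2) limit_set_decomposition by simp
  have passes: "common_side_midpoint (m 1) u v \<in> K \<inter> piece u \<inter> piece v" if "l = xs @ [u, v] @ ys" for xs u v ys
  proof (rule pieces.connected_contains_walk_points[OF K(1) cover])
    show "distinct (xs @ [u, v] @ ys)" using l(1) that by simp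
    show "successively (\<lambda>x y. (x, y) \<in> pattern_edges (A 1)) (xs @ [u, v] @ ys)" using walk that by simp
    show "p \<in> K" "q \<in> K" by fact+
    show "p \<in> piece (hd (xs @ [u]))" using start l(4) that by (cases xs) auto
    show "q \<in> piece (last (v # ys))" using finish l(5) that by simp
  qed
  define inner where "inner = butlast (tl l)"
  have "crosses_square (zoom s K)" if s: "s \<in> set inner" for s
  proof -
    obtain xs ys where xs: "inner = xs @ s # ys" using split_list[OF s] by blast
    have ne: "tl l \<noteq> []" using s by (auto simp: inner_def)
    then have "l \<noteq> []" by auto
    then have "l = hd l # tl l" by simp
    also have "tl l = inner @ [last (tl l)]" using ne by (simp add: inner_def)
    finally have l_eq: "l = hd l # xs @ s # ys @ [last (tl l)]" by (simp add: xs)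
    define as where "as = butlast (hd l # xs)"
    define a where "a = last (hd l # xs)"
    define b where "b = hd (ys @ [last (tl l)])"
    define bs where "bs = tl (ys @ [last (tl l)])"
    have "hd l # xs = as @ [a]" "ys @ [last (tl l)] = b # bs"
      by (simp_all add: as_def a_def b_def bs_def del: last.simps butlast.simps)
    then have l1: "l = as @ [a, s] @ (b # bs)" and l2: "l = (as @ [a]) @ [s, b] @ bs"
      using l_eq by (metis append.assoc append_Cons append_Nil)+
    have "a \<noteq> b" "side_adjacent a s" "side_adjacent s b"
      using l(1,2) by (auto simp: l1 successively_append_iff)
    moreover have "side_adjacent s a" using \<open>side_adjacent a s\<close> by (auto simp: side_adjacent_def)
    ultimately show ?thesis
      using passes[OF l1] passes[OF l2] common_side_midpoint_commute[of "m 1" a s]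
      by (intro crosses_zoom[of s a K b]) auto
  qed
  moreover have "set inner \<subseteq> A 1"
    using l(3) snake_subset unfolding inner_def by (cases l) (auto dest: in_set_butlastD)
  moreover have "card (set inner) \<ge> (j + 1)\<^sup>2"
    using l(1,6) by (simp add: inner_def distinct_card distinct_butlast distinct_tl)
  then obtain T where "T \<subseteq> set inner" "card T = (j + 1)\<^sup>2" by (meson obtain_subset_with_card_n)
  ultimately show ?thesis by blast
qed

text \<open>
The first step of the walk from \<open>s\<close> to \<open>t\<close> in the tree.  Either the walk ends after this step, or its
second vertex is an intermediate one and is crossed.
\<close>

lemma next_piece_towards_point:
  assumes K: "connected K" "K \<subseteq> limit"
    and s: "s \<in> A 1" "a \<in> K" "a \<in> piece s" and t: "t \<in> A 1" "b \<in> K" "b \<in> piece t" and ne: "s \<noteq> t"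
  obtains u where "u \<in> A 1" "side_adjacent s u" "common_side_midpoint (m 1) s u \<in> K \<inter> piece s \<inter> piece u"
    "b \<in> piece u \<or> crosses_square (zoom u K)"
proof -
  have "(s, t) \<in> (pattern_edges (A 1))\<^sup>*"
    using labyrinth[of 1] s t by (simp add: labyrinth_pattern_def is_tree_def)
  from rtrancl_imp_distinct_walk[OF this] obtain l where l: "l \<noteq> []" "hd l = s" "last l = t" "distinct l"
    "successively (\<lambda>x y. (x, y) \<in> pattern_edges (A 1)) l" by blast
  obtain u ys where l1: "l = [] @ [s, u] @ ys"
    using l(1-3) ne by (cases l rule: remdups_adj.cases) auto
  have cover: "K \<subseteq> (\<Union>s\<in>A 1. piece s)" using K(2) limit_set_decomposition by simp
  have passes: "common_side_midpoint (m 1) x y \<in> K \<inter> piece x \<inter> piece y" if "l = xs @ [x, y] @ ys" for xs x y ys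
  proof (rule pieces.connected_contains_walk_points[OF K(1) cover])
    show "distinct (xs @ [x, y] @ ys)" using l(4) that by simp
    show "successively (\<lambda>x y. (x, y) \<in> pattern_edges (A 1)) (xs @ [x, y] @ ys)" using l(5) that by simp
    show "a \<in> K" "b \<in> K" by fact+
    show "a \<in> piece (hd (xs @ [x]))" using s l(2) that by (cases xs) auto
    show "b \<in> piece (last (y # ys))" using t l(3) that by simp
  qed
  have su: "(s, u) \<in> pattern_edges (A 1)" using l(5) by (simp add: l1)
  have "b \<in> piece u \<or> crosses_square (zoom u K)"
  proof (cases ys)
    case Nil
    then show ?thesis using l(3) t by (simp add: l1)
  next
    case (Cons v zs)
    then have l2: "l = [s] @ [u, v] @ zs" by (simp add: l1)
    have "s \<noteq> v" "side_adjacent u v" using l(4,5) by (auto simp: l2 pattern_edges_def)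
    moreover have "side_adjacent u s" using su by (auto simp: pattern_edges_def side_adjacent_def)
    ultimately have "crosses_square (zoom u K)"
      using passes[OF l1] passes[OF l2] common_side_midpoint_commute[of "m 1" s u]
      by (intro crosses_zoom[of u s K v]) auto
    then show ?thesis ..
  qed
  moreover have "u \<in> A 1" "side_adjacent s u" using su by (auto simp: pattern_edges_def)
  ultimately show ?thesis using that[OF _ _ passes[OF l1]] by blast
qed

end

section \<open>Counting the grid squares that a set meets\<close>

definition squares_met :: "nat \<Rightarrow> (real \<times> real) set \<Rightarrow> (nat \<times> nat) set" where
  "squares_met M F = {t \<in> grid M. square M t \<inter> F \<noteq> {}}"

lemma finite_squares_met: "finite (squares_met M F)"
  by (rule finite_subset[of _ "grid M"]) (auto simp: squares_met_def grid_def)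

lemma squares_met_mono: "F \<subseteq> G \<Longrightarrow> squares_met M F \<subseteq> squares_met M G"
  by (auto simp: squares_met_def)

lemma squares_met_unit: "F \<subseteq> square 1 (0, 0) \<Longrightarrow> F \<noteq> {} \<Longrightarrow> squares_met 1 F = {(0, 0)}"
  by (auto simp: squares_met_def grid_def)

text \<open>
Squares met in different cells of the coarse grid are different squares of the fine grid, so the
counts in the cells add up.
\<close>

lemma card_squares_met_refine:
  assumes M: "M \<ge> 1" "M' \<ge> 1" and T: "T \<subseteq> grid M"
    and many: "\<And>s. s \<in> T \<Longrightarrow> C \<le> card (squares_met M' (square_map M s -` F))"
  shows "card T * C \<le> card (squares_met (M * M') F)"
proof -
  let ?S = "SIGMA s:T. squares_met M' (square_map M s -` F)"
  let ?r = "\<lambda>(s, t). refine M' s t"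
  have fin: "finite T" using T by (rule finite_subset) (simp add: grid_def)
  have "card T * C \<le> (\<Sum>s\<in>T. card (squares_met M' (square_map M s -` F)))"
    using sum_mono[of T "\<lambda>_. C"] many by simp
  also have "\<dots> = card ?S" by (rule card_SigmaI[symmetric]) (simp_all add: fin finite_squares_met)
  also have "\<dots> = card (?r ` ?S)"
  proof (rule card_image[symmetric], rule inj_onI)
    fix x y assume x: "x \<in> ?S" and y: "y \<in> ?S" and eq: "?r x = ?r y"
    have dm: "(a * M' + b) div M' = a \<and> (a * M' + b) mod M' = b" if "b < M'" for a b :: nat
      using that by simp
    obtain s t s' t' where xy: "x = (s, t)" "y = (s', t')" by (cases x, cases y)
    have "t \<in> grid M'" "t' \<in> grid M'" using x y xy by (auto simp: squares_met_def)
    then have lt: "fst t < M'" "snd t < M'" "fst t' < M'" "snd t' < M'" by (auto simp: grid_def)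
    have e: "fst s * M' + fst t = fst s' * M' + fst t'" "snd s * M' + snd t = snd s' * M' + snd t'"
      using eq by (simp_all add: xy refine_def)
    have "fst s = fst s'" "fst t = fst t'" using dm[OF lt(1), of "fst s"] dm[OF lt(3), of "fst s'"] e(1) by metis+
    moreover have "snd s = snd s'" "snd t = snd t'" using dm[OF lt(2), of "snd s"] dm[OF lt(4), of "snd s'"] e(2) by metis+
    ultimately show "x = y" by (simp add: xy prod_eq_iff)
  qed
  also have "\<dots> \<le> card (squares_met (M * M') F)"
  proof (rule card_mono[OF finite_squares_met], rule subsetI)
    fix x assume "x \<in> ?r ` ?S"
    then obtain y where y: "y \<in> ?S" "x = ?r y" by blast
    obtain s t where "y = (s, t)" by (cases y)
    with y have st: "s \<in> T" "t \<in> squares_met M' (square_map M s -` F)" and x: "x = refine M' s t"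
      by simp_all
    have lt: "fst s < M" "snd s < M" "fst t < M'" "snd t < M'"
      using st T by (auto simp: squares_met_def grid_def)
    have "a * M' + b < M * M'" if "a < M" "b < M'" for a b
    proof -
      have "a * M' + b < (a + 1) * M'" using that by simp
      also have "\<dots> \<le> M * M'" using that by (intro mult_le_mono1) simp
      finally show ?thesis .
    qed
    then have "refine M' s t \<in> grid (M * M')" using lt by (simp add: refine_def grid_def)
    moreover obtain w where "w \<in> square M' t" "square_map M s w \<in> F"
      using st(2) unfolding squares_met_def by blast
    then have "square_map M s w \<in> square (M * M') (refine M' s t) \<inter> F"
      using square_map_image_square[OF M, of s t] by blast
    ultimately show "x \<in> squares_met (M * M') F"
      unfolding squares_met_def x by blast
  qed
  finally show ?thesis .
qed

text \<open>
From level \<open>d\<close> on, at least the product of \<open>(j + k)\<^sup>2\<close> over \<open>d < k \<le> r\<close> squares of level \<open>r\<close> are met;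
the quotient of factorials is multiplied out to stay within the natural numbers.
\<close>

definition meets_factorially_many :: "nat \<Rightarrow> (nat \<Rightarrow> nat) \<Rightarrow> nat \<Rightarrow> (real \<times> real) set \<Rightarrow> bool" where
  "meets_factorially_many j m d F \<longleftrightarrow>
     (\<forall>r\<ge>d. (fact (j + r))\<^sup>2 \<le> card (squares_met (width_prod m r) F) * (fact (j + d) :: nat)\<^sup>2)"

context snake_sequence
begin

lemma card_squares_met_from_zooms:
  assumes "T \<subseteq> A 1" "\<And>s. s \<in> T \<Longrightarrow> C \<le> card (squares_met (width_prod (m \<circ> Suc) n) (zoom s K))"
  shows "card T * C \<le> card (squares_met (width_prod m (Suc n)) K)"
  unfolding width_prod_Suc_front
proof (rule card_squares_met_refine)
  show "m 1 \<ge> 1" by (simp add: width_Suc_0)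
  show "width_prod (m \<circ> Suc) n \<ge> 1" by (rule width_prod_ge_1) (rule tail.width_ge_1)
  show "T \<subseteq> grid (m 1)" using assms(1) pattern_subset_grid by blast
  show "C \<le> card (squares_met (width_prod (m \<circ> Suc) n) (square_map (m 1) s -` K))" if "s \<in> T" for s
  proof -
    have "zoom s K \<subseteq> square_map (m 1) s -` K" by (auto simp: zoom_def)
    from card_mono[OF finite_squares_met squares_met_mono[OF this]] assms(2)[OF that]
    show ?thesis by (rule order_trans[rotated])
  qed
qed

lemma meets_factorially_many_from_zoom:
  assumes s: "s \<in> A 1" and many: "meets_factorially_many (Suc j) (m \<circ> Suc) d (zoom s K)"
  shows "meets_factorially_many j m (Suc d) K"
  unfolding meets_factorially_many_def
proof (intro allI impI)
  fix r assume "Suc d \<le> r"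
  then obtain r' where r: "r = Suc r'" "d \<le> r'" by (cases r) auto
  have "card {s} * card (squares_met (width_prod (m \<circ> Suc) r') (zoom s K)) \<le> card (squares_met (width_prod m r) K)"
    unfolding r(1) by (rule card_squares_met_from_zooms) (use s in auto)
  then have le: "card (squares_met (width_prod (m \<circ> Suc) r') (zoom s K)) \<le> card (squares_met (width_prod m r) K)"
    by simp
  have "(fact (Suc j + r'))\<^sup>2 \<le>
      card (squares_met (width_prod (m \<circ> Suc) r') (zoom s K)) * (fact (Suc j + d) :: nat)\<^sup>2"
    using many r(2) unfolding meets_factorially_many_def by blast
  also have "\<dots> \<le> card (squares_met (width_prod m r) K) * (fact (Suc j + d) :: nat)\<^sup>2"
    using le by (rule mult_le_mono1)
  finally show "(fact (j + r))\<^sup>2 \<le> card (squares_met (width_prod m r) K) * (fact (j + Suc d) :: nat)\<^sup>2"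
    by (simp only: r(1) add_Suc add_Suc_right)
qed

text \<open>
One level of the induction: \<open>(j + 1)\<^sup>2\<close> pieces contribute equally many squares each.
\<close>

lemma factorial_bound_Suc:
  assumes T: "T \<subseteq> A 1" "card T = (j + 1)\<^sup>2"
    and many: "\<And>s. s \<in> T \<Longrightarrow> (fact (Suc j + r))\<^sup>2 \<le>
       card (squares_met (width_prod (m \<circ> Suc) r) (zoom s K)) * (fact (Suc j) :: nat)\<^sup>2"
  shows "(fact (j + Suc r))\<^sup>2 \<le> card (squares_met (width_prod m (Suc r)) K) * (fact j :: nat)\<^sup>2"
proof -
  define C where "C = Min ((\<lambda>s. card (squares_met (width_prod (m \<circ> Suc) r) (zoom s K))) ` T)"
  have fin: "finite T" using T(1) finite_pattern[of 1] finite_subset by auto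
  have ne: "T \<noteq> {}" using T(2) by auto
  have "C \<in> (\<lambda>s. card (squares_met (width_prod (m \<circ> Suc) r) (zoom s K))) ` T"
    unfolding C_def by (rule Min_in) (use fin ne in auto)
  then have C: "(fact (Suc j + r))\<^sup>2 \<le> C * (fact (Suc j) :: nat)\<^sup>2" using many by auto
  have "card T * C \<le> card (squares_met (width_prod m (Suc r)) K)"
    by (rule card_squares_met_from_zooms[OF T(1)]) (simp add: C_def fin)
  then have le: "(j + 1)\<^sup>2 * C \<le> card (squares_met (width_prod m (Suc r)) K)" by (simp only: T(2))
  note C
  also have "C * (fact (Suc j) :: nat)\<^sup>2 = (j + 1)\<^sup>2 * C * (fact j)\<^sup>2"
  proof -
    have "fact (Suc j) = (j + 1) * (fact j :: nat)" by simp
    then show ?thesis by (simp only: power_mult_distrib mult_ac)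
  qed
  also have "\<dots> \<le> card (squares_met (width_prod m (Suc r)) K) * (fact j :: nat)\<^sup>2"
    using le by (rule mult_le_mono1)
  finally show ?thesis by (simp only: add_Suc add_Suc_right)
qed

text \<open>
Compactness, applied to the decreasing sequence of nonempty level sets.
\<close>

lemma limit_nonempty: "limit \<noteq> {}"
proof -
  have "white m A n \<noteq> {}" for n
  proof (induction n)
    case (Suc n)
    have "A (Suc n) \<noteq> {}" using patterns[of "Suc n"] by (simp add: pattern_def)
    with Suc show ?case by (simp only: white.simps) blast
  qed simp
  moreover have W: "width_prod m n \<ge> 1" for n by (rule width_prod_ge_1) (rule width_ge_1)
  have "square (width_prod m n) s \<noteq> {}" for n s
  proof -
    have "(real (fst s) / real (width_prod m n), real (snd s) / real (width_prod m n)) \<in> square (width_prod m n) s"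
      using W[of n] by (simp add: mem_square_iff divide_right_mono)
    then show ?thesis by blast
  qed
  ultimately have ne: "level_set m A n \<noteq> {}" for n unfolding level_set_def by blast
  have "compact (level_set m A n)" for n
    unfolding level_set_def square_def
    by (intro compact_UN finite_white compact_Times compact_Icc)
  then have "\<Inter> (range (level_set m A)) \<noteq> {}"
    by (rule compact_nest) (use ne level_set_antimono in blast)+
  then show ?thesis by (simp add: limit_set_eq_all_levels)
qed

end

text \<open>
Any \<open>(j + 1)\<^sup>2\<close> white squares will do here, because the trace of the limit set on each of its pieces is
a full copy of the next limit set; the squares of a walk through the snake cross are sufficiently many.
\<close>

lemma limit_meets_factorially_many:
  assumes "snake_sequence j m A"
  shows "(fact (j + r))\<^sup>2 \<le> card (squares_met (width_prod m r) (limit_set m A)) * (fact j :: nat)\<^sup>2"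
  using assms
proof (induction r arbitrary: j m A)
  case 0
  then interpret snake_sequence j m A .
  have "width_prod m 0 = 1" by (simp add: width_prod_def)
  then show ?case using squares_met_unit[OF limit_set_subset_unit_square limit_nonempty] by simp
next
  case (Suc r)
  then interpret snake_sequence j m A by simp
  obtain p where p: "distinct p" "set p \<subseteq> snake_cross (j + 1)" "length p \<ge> (j + 1)\<^sup>2 + 2"
    using snake_cross_walk[of 0 1 "j + 1"] by (metis one_less_numeral_iff semiring_norm(76) zero_less_numeral zero_neq_one)
  then have "(j + 1)\<^sup>2 \<le> card (set p)" by (simp add: distinct_card)
  then obtain T where T: "T \<subseteq> set p" "card T = (j + 1)\<^sup>2" by (meson obtain_subset_with_card_n)
  have TA: "T \<subseteq> A 1" using T(1) p(2) snake_subset by blast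
  have zoom: "zoom s limit = tail_limit" if "s \<in> T" for s
    using that TA limit_set_decomposition by (auto simp: zoom_def)
  show ?case
  proof (rule factorial_bound_Suc[OF TA T(2)])
    fix s assume "s \<in> T"
    show "(fact (Suc j + r))\<^sup>2 \<le>
        card (squares_met (width_prod (m \<circ> Suc) r) (zoom s limit)) * (fact (Suc j) :: nat)\<^sup>2"
      unfolding zoom[OF \<open>s \<in> T\<close>] by (rule Suc.IH[OF shift])
  qed
qed

lemma crossing_meets_factorially_many:
  assumes "snake_sequence j m A" "connected K" "K \<subseteq> limit_set m A" "crosses_square K"
  shows "(fact (j + r))\<^sup>2 \<le> card (squares_met (width_prod m r) K) * (fact j :: nat)\<^sup>2"
  using assms
proof (induction r arbitrary: j m A K)
  case 0
  then interpret snake_sequence j m A by simp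
  have "K \<noteq> {}" "K \<subseteq> square 1 (0, 0)"
    using 0 limit_set_subset_unit_square by (auto simp: crosses_square_def)
  moreover have "width_prod m 0 = 1" by (simp add: width_prod_def)
  ultimately show ?case using squares_met_unit[of K] by simp
next
  case (Suc r)
  then interpret snake_sequence j m A by simp
  obtain T where T: "T \<subseteq> A 1" "card T = (j + 1)\<^sup>2" "\<And>s. s \<in> T \<Longrightarrow> crosses_square (zoom s K)"
    using crossing_meets_many_pieces[OF Suc.prems(2-4)] by blast
  show ?case
  proof (rule factorial_bound_Suc[OF T(1,2)])
    fix s assume "s \<in> T"
    then show "(fact (Suc j + r))\<^sup>2 \<le> card (squares_met (width_prod (m \<circ> Suc) r) (zoom s K)) * (fact (Suc j) :: nat)\<^sup>2"
      using T by (intro Suc.IH[OF shift] connected_zoom Suc.prems zoom_subset) auto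
  qed
qed

section \<open>Connected sets with two points cross a deep piece\<close>

lemma (in snake_sequence) zoomE:
  assumes "a \<in> K" "K \<subseteq> limit"
  obtains s w where "s \<in> A 1" "w \<in> zoom s K" "a = square_map (m 1) s w" "a \<in> piece s"
proof -
  have "a \<in> (\<Union>s\<in>A 1. piece s)" using assms limit_set_decomposition by blast
  then obtain s w where s: "s \<in> A 1" "w \<in> tail_limit" "a = square_map (m 1) s w" by blast
  with assms(1) have "w \<in> zoom s K" by (simp add: zoom_def)
  with that s show ?thesis by blast
qed

text \<open>
Zooming in multiplies distances by at least 3.  The assumption can therefore serve as an induction
principle: at \<open>n = 0\<close> it contradicts the size of the unit square.
\<close>

lemma (in snake_sequence) dist_zoom_ge:
  assumes "2 < dist (square_map (m 1) s v) (square_map (m 1) s w) * 3 ^ Suc n"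
  shows "2 < dist v w * 3 ^ n"
proof -
  let ?D = "dist (square_map (m 1) s v) (square_map (m 1) s w)"
  have "3 * ?D \<le> real (m 1) * ?D" by (intro mult_right_mono) (simp_all add: width_Suc_0)
  also have "\<dots> = dist v w" by (simp add: dist_square_map width_Suc_0)
  finally have "(3 * ?D) * 3 ^ n \<le> dist v w * 3 ^ n" by (intro mult_right_mono) simp_all
  moreover have "2 < (3 * ?D) * 3 ^ n" using assms by (simp add: mult_ac)
  ultimately show ?thesis by (rule less_le_trans[rotated])
qed

lemma (in snake_sequence) dist_limit_le:
  assumes "a \<in> limit" "b \<in> limit"
  shows "dist a b \<le> 2"
proof -
  have "0 \<le> fst a \<and> fst a \<le> 1 \<and> 0 \<le> snd a \<and> snd a \<le> 1"
    "0 \<le> fst b \<and> fst b \<le> 1 \<and> 0 \<le> snd b \<and> snd b \<le> 1"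
    using assms limit_set_subset_unit_square mem_unit_square_iff by blast+
  then have "\<bar>fst a - fst b\<bar> \<le> 1" "\<bar>snd a - snd b\<bar> \<le> 1" by auto
  moreover have "dist a b \<le> \<bar>fst a - fst b\<bar> + \<bar>snd a - snd b\<bar>"
    using sqrt_sum_squares_le_sum_abs[of "fst a - fst b" "snd a - snd b"]
    by (simp add: dist_prod_def dist_real_def)
  ultimately show ?thesis by linarith
qed

text \<open>
Zooming in on the fixed point \<open>p\<close> separates it at last from \<open>a\<close>.  The walk towards \<open>a\<close> then leaves the
piece of \<open>p\<close> through a side that is not on the boundary of the unit square, so the trace on this piece
contains a second side midpoint.
\<close>

lemma connected_with_side_midpoint:
  assumes "snake_sequence j m A" "connected K" "K \<subseteq> limit_set m A"
    and "p \<in> side_midpoints" "p \<in> K" "a \<in> K" "2 < dist a p * 3 ^ n"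
  shows "\<exists>d. meets_factorially_many j m d K"
  using assms
proof (induction n arbitrary: j m A K a)
  case 0
  then interpret snake_sequence j m A by simp
  have "dist a p \<le> 2" using 0 by (intro dist_limit_le) auto
  then show ?case using 0 by simp
next
  case (Suc n)
  then interpret snake_sequence j m A by simp
  obtain s where s: "s \<in> A 1" "p \<in> piece s" "p \<in> tail_limit" "square_map (m 1) s p = p"
    using side_midpoint_fixed_by_exit_piece[of p] Suc.prems by blast
  have pz: "p \<in> zoom s K" using s Suc.prems by (simp add: zoom_def)
  have con: "connected (zoom s K)" using connected_zoom Suc.prems s by blast
  have "\<exists>d. meets_factorially_many (Suc j) (m \<circ> Suc) d (zoom s K)"
  proof (cases "a \<in> piece s")
    case True
    then obtain w where w: "a = square_map (m 1) s w" "w \<in> tail_limit" by blast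
    then have "w \<in> zoom s K" using Suc.prems by (simp add: zoom_def)
    moreover have "2 < dist w p * 3 ^ n"
      using Suc.prems(7) dist_zoom_ge[of s w p n] w s by simp
    ultimately show ?thesis using Suc.IH[OF shift con zoom_subset Suc.prems(4) pz] by blast
  next
    case False
    obtain t where t: "t \<in> A 1" "a \<in> piece t" by (rule zoomE[OF Suc.prems(6,3)])
    have ne: "s \<noteq> t" using False t(2) by blast
    obtain u where u: "u \<in> A 1" "side_adjacent s u"
      "common_side_midpoint (m 1) s u \<in> K \<inter> piece s \<inter> piece u"
      "a \<in> piece u \<or> crosses_square (zoom u K)"
      by (rule next_piece_towards_point[OF Suc.prems(2,3) s(1) Suc.prems(5) s(2) t(1) Suc.prems(6) t(2) ne])
    obtain w where w: "w \<in> zoom s K" "w \<in> side_midpoints"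
      "square_map (m 1) s w = common_side_midpoint (m 1) s u"
      by (rule common_side_midpoint_in_zoom[OF IntD1[OF u(3)] u(2)])
    have "w \<noteq> p"
      using common_side_midpoint_not_side_midpoint[OF s(1) u(1)] w(3) s(4) Suc.prems(4) by metis
    then have "crosses_square (zoom s K)" using w pz Suc.prems(4) by (auto simp: crosses_square_def)
    then have "meets_factorially_many (Suc j) (m \<circ> Suc) 0 (zoom s K)"
      using crossing_meets_factorially_many[OF shift con zoom_subset] by (simp add: meets_factorially_many_def)
    then show ?thesis ..
  qed
  then show ?case using meets_factorially_many_from_zoom[OF s(1)] by blast
qed

lemma dist_power_unbounded: "a \<noteq> b \<Longrightarrow> \<exists>n. 2 < dist a b * 3 ^ n"
proof -
  assume "a \<noteq> b"
  then have d: "0 < dist a b" by simp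
  obtain n where "2 / dist a b < 3 ^ n" using real_arch_pow[of 3 "2 / dist a b"] by auto
  with d show ?thesis by (auto simp: field_simps)
qed

text \<open>
Once the two points lie in different pieces, the walk from one to the other passes a common side
midpoint \<open>q\<close>.  At least one of the points is different from \<open>q\<close>, which leads to the situation of a
connected set with a side midpoint and another point; if \<open>a\<close> equals \<open>q\<close>, the neighbouring piece is used,
which is crossed unless it already contains \<open>b\<close>.
\<close>

lemma connected_two_points:
  assumes "snake_sequence j m A" "connected K" "K \<subseteq> limit_set m A"
    and "a \<in> K" "b \<in> K" "2 < dist a b * 3 ^ n"
  shows "\<exists>d. meets_factorially_many j m d K"
  using assms
proof (induction n arbitrary: j m A K a b)
  case 0
  then interpret snake_sequence j m A by simp
  have "dist a b \<le> 2" using 0 by (intro dist_limit_le) auto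
  then show ?case using 0 by simp
next
  case (Suc n)
  then interpret snake_sequence j m A by simp
  have con: "connected (zoom s K)" if "s \<in> A 1" for s using connected_zoom Suc.prems that by blast
  have from_midpoint: "\<exists>d. meets_factorially_many (Suc j) (m \<circ> Suc) d (zoom s K)"
    if "s \<in> A 1" "p \<in> zoom s K" "p \<in> side_midpoints" "w \<in> zoom s K" "w \<noteq> p" for s p w
    using dist_power_unbounded[OF that(5)]
      connected_with_side_midpoint[OF shift con[OF that(1)] zoom_subset that(3,2,4)] by blast
  obtain s v where s: "s \<in> A 1" "v \<in> zoom s K" "a = square_map (m 1) s v" "a \<in> piece s"
    by (rule zoomE[OF Suc.prems(4,3)])
  have "\<exists>s\<in>A 1. \<exists>d. meets_factorially_many (Suc j) (m \<circ> Suc) d (zoom s K)"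
  proof (cases "b \<in> piece s")
    case True
    then obtain w where w: "b = square_map (m 1) s w" "w \<in> tail_limit" by blast
    then have "w \<in> zoom s K" using Suc.prems by (simp add: zoom_def)
    moreover have "2 < dist v w * 3 ^ n"
      using Suc.prems(6) dist_zoom_ge[of s v w n] w s by simp
    ultimately show ?thesis using Suc.IH[OF shift con[OF s(1)] zoom_subset s(2)] s(1) by blast
  next
    case False
    obtain t where t: "t \<in> A 1" "b \<in> piece t" by (rule zoomE[OF Suc.prems(5,3)])
    have ne: "s \<noteq> t" using False t(2) by blast
    obtain u where u: "u \<in> A 1" "side_adjacent s u"
      "common_side_midpoint (m 1) s u \<in> K \<inter> piece s \<inter> piece u"
      "b \<in> piece u \<or> crosses_square (zoom u K)"
      by (rule next_piece_towards_point[OF Suc.prems(2,3) s(1) Suc.prems(4) s(4) t(1) Suc.prems(5) t(2) ne])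
    let ?q = "common_side_midpoint (m 1) s u"
    obtain p where p: "p \<in> zoom s K" "p \<in> side_midpoints" "square_map (m 1) s p = ?q"
      by (rule common_side_midpoint_in_zoom[OF IntD1[OF u(3)] u(2)])
    have us: "side_adjacent u s" using u(2) by (auto simp: side_adjacent_def)
    have qu: "common_side_midpoint (m 1) u s \<in> K \<inter> piece u"
      using u(3) unfolding common_side_midpoint_commute[of "m 1" u s] by blast
    obtain p' where p': "p' \<in> zoom u K" "p' \<in> side_midpoints" "square_map (m 1) u p' = ?q"
      by (rule common_side_midpoint_in_zoom[OF qu us]) (simp only: common_side_midpoint_commute[of "m 1" u s])
    consider "crosses_square (zoom u K)" | "a \<noteq> ?q" | "b \<in> piece u" "b \<noteq> ?q"
      using u(4) Suc.prems(6) by fastforce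
    then show ?thesis
    proof cases
      case 1
      then have "meets_factorially_many (Suc j) (m \<circ> Suc) 0 (zoom u K)"
        using crossing_meets_factorially_many[OF shift con[OF u(1)] zoom_subset]
        by (simp add: meets_factorially_many_def)
      then show ?thesis using u(1) by blast
    next
      case 2
      then have "v \<noteq> p" using p(3) s(3) by auto
      then show ?thesis using from_midpoint[OF s(1) p(1,2) s(2)] s(1) by blast
    next
      case 3
      then obtain w where w: "b = square_map (m 1) u w" "w \<in> tail_limit" by blast
      then have "w \<in> zoom u K" using Suc.prems by (simp add: zoom_def)
      moreover have "w \<noteq> p'" using p'(3) w(1) 3 by auto
      ultimately show ?thesis using from_midpoint[OF u(1) p'(1,2)] u(1) by blast
    qed
  qed
  then show ?case using meets_factorially_many_from_zoom by blast
qed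

section \<open>Box numbers and grid squares\<close>

lemma abs_diff_le_dist:
  fixes z w :: "real \<times> real"
  shows "\<bar>fst z - fst w\<bar> \<le> dist z w" "\<bar>snd z - snd w\<bar> \<le> dist z w"
  using dist_fst_le[of z w] dist_snd_le[of z w] by (simp_all add: dist_real_def)

text \<open>
In each coordinate a set of diameter at most \<open>1 / M\<close> can touch only intervals of the grid with four
consecutive indices; the bound is crude, but only its independence of \<open>M\<close> matters.
\<close>

lemma card_squares_met_small_set:
  assumes M: "M \<ge> 1" and U: "bounded U" "diameter U \<le> 1 / real M"
  shows "card (squares_met M U) \<le> 16"
proof (cases "U = {}")
  case True
  then show ?thesis by (simp add: squares_met_def)
next
  case False
  then obtain w where w: "w \<in> U" by blast
  let ?I = "\<lambda>x::real. {\<lfloor>real M * x\<rfloor> - 2 .. \<lfloor>real M * x\<rfloor> + 1}"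
  let ?f = "\<lambda>t::nat \<times> nat. (int (fst t), int (snd t))"
  have M0: "real M > 0" using M by simp
  have near: "int i \<in> ?I x"
    if "real i / real M \<le> y" "y \<le> (real i + 1) / real M" "\<bar>y - x\<bar> \<le> 1 / real M" for i x y
  proof -
    have "real i \<le> real M * y" "real M * y \<le> real i + 1"
      using that(1,2) M0 by (simp_all add: field_simps)
    moreover have "real M * \<bar>y - x\<bar> \<le> 1" using that(3) M0 by (simp add: field_simps)
    then have "\<bar>real M * y - real M * x\<bar> \<le> 1"
      using M0 by (simp add: abs_mult flip: right_diff_distrib)
    ultimately have "real i \<le> real M * x + 1" "real M * x \<le> real i + 2" by linarith+
    then show ?thesis by (simp, linarith)
  qed
  have "?f ` squares_met M U \<subseteq> ?I (fst w) \<times> ?I (snd w)"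
  proof
    fix x assume "x \<in> ?f ` squares_met M U"
    then obtain t where t: "t \<in> squares_met M U" "x = ?f t" by blast
    then obtain z where z: "z \<in> U" "z \<in> square M t" unfolding squares_met_def by blast
    have "dist z w \<le> 1 / real M"
      using diameter_bounded_bound[OF U(1) z(1) w] U(2) by linarith
    then have "\<bar>fst z - fst w\<bar> \<le> 1 / real M" "\<bar>snd z - snd w\<bar> \<le> 1 / real M"
      using abs_diff_le_dist[of z w] by linarith+
    then have "int (fst t) \<in> ?I (fst w)" "int (snd t) \<in> ?I (snd w)"
      using near[of "fst t" "fst z" "fst w"] near[of "snd t" "snd z" "snd w"] z(2)
      unfolding mem_square_iff by blast+
    then show "x \<in> ?I (fst w) \<times> ?I (snd w)" using t(2) by blast
  qed
  moreover have "inj_on ?f (squares_met M U)" by (auto simp: inj_on_def prod_eq_iff)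
  ultimately have "card (squares_met M U) \<le> card (?I (fst w) \<times> ?I (snd w))"
    by (intro card_inj_on_le) auto
  also have "\<dots> = 16" by (simp only: card_cartesian_product card_atLeastAtMost_int) simp
  finally show ?thesis .
qed

lemma diameter_square_le: "M \<ge> 1 \<Longrightarrow> diameter (square M s) \<le> 2 / real M"
proof (rule diameter_le)
  assume "M \<ge> 1"
  then show "square M s \<noteq> {} \<or> 0 \<le> 2 / real M" by simp
  fix z w assume z: "z \<in> square M s" and w: "w \<in> square M s"
  have d: "(real i + 1) / real M = real i / real M + 1 / real M" for i by (simp add: add_divide_distrib)
  have "\<bar>fst z - fst w\<bar> \<le> 1 / real M" "\<bar>snd z - snd w\<bar> \<le> 1 / real M"
    using z w unfolding mem_square_iff d by linarith+
  moreover have "norm (z - w) \<le> \<bar>fst z - fst w\<bar> + \<bar>snd z - snd w\<bar>"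
    using sqrt_sum_squares_le_sum_abs[of "fst z - fst w" "snd z - snd w"]
    by (simp add: norm_prod_def)
  ultimately show "norm (z - w) \<le> 2 / real M" by (simp add: field_simps)
qed

lemma bounded_square: "bounded (square M s)"
  unfolding square_def by (intro bounded_Times bounded_closed_interval)

text \<open>
One more row and column than necessary, so that points with a coordinate equal to 1 need no special
treatment.
\<close>

lemma unit_square_covered:
  assumes M: "M \<ge> 1"
  shows "square 1 (0, 0) \<subseteq> (\<Union>s\<in>grid (M + 1). square M s)"
proof
  fix z assume z: "z \<in> square 1 (0, 0)"
  have M0: "real M > 0" using M by simp
  have idx: "\<exists>i<M + 1. real i / real M \<le> x \<and> x \<le> (real i + 1) / real M" if "0 \<le> x" "x \<le> 1" for x
  proof (intro exI conjI)
    have fl: "real (nat \<lfloor>real M * x\<rfloor>) = of_int \<lfloor>real M * x\<rfloor>" using that by simp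
    have le: "real (nat \<lfloor>real M * x\<rfloor>) \<le> real M * x" "real M * x \<le> real (nat \<lfloor>real M * x\<rfloor>) + 1"
      unfolding fl by linarith+
    have "real M * x \<le> real M" using that M0 by (simp add: mult_left_le)
    with le(1) have "real (nat \<lfloor>real M * x\<rfloor>) \<le> real M" by linarith
    then show "nat \<lfloor>real M * x\<rfloor> < M + 1" by simp
    show "real (nat \<lfloor>real M * x\<rfloor>) / real M \<le> x" "x \<le> (real (nat \<lfloor>real M * x\<rfloor>) + 1) / real M"
      using le M0 by (simp_all add: pos_divide_le_eq pos_le_divide_eq mult.commute)
  qed
  have "0 \<le> fst z" "fst z \<le> 1" "0 \<le> snd z" "snd z \<le> 1" using z mem_unit_square_iff by blast+
  then obtain i k where "i < M + 1" "real i / real M \<le> fst z" "fst z \<le> (real i + 1) / real M"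
    "k < M + 1" "real k / real M \<le> snd z" "snd z \<le> (real k + 1) / real M"
    using idx by meson
  then have "z \<in> square M (i, k)" "(i, k) \<in> grid (M + 1)" by (simp_all add: mem_square_iff grid_def)
  then show "z \<in> (\<Union>s\<in>grid (M + 1). square M s)" by blast
qed

text \<open>
A grid of mesh at most \<open>\<delta> / 2\<close> provides a cover.  Its size bounds the box number, and its existence
guarantees that the least number in the definition of \<open>box_number\<close> is attained.
\<close>

lemma box_number_cover:
  assumes F: "F \<subseteq> square 1 (0, 0)" and d: "0 < \<delta>" "\<delta> < 1"
  shows "real (box_number \<delta> F) \<le> 16 / \<delta>\<^sup>2"
    and "\<exists>C. finite C \<and> card C = box_number \<delta> F \<and> F \<subseteq> \<Union> C \<and> (\<forall>U \<in> C. bounded U \<and> diameter U \<le> \<delta>)"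
proof -
  define M where "M = nat \<lceil>2 / \<delta>\<rceil>"
  have M: "2 / \<delta> \<le> real M" "real M \<le> 2 / \<delta> + 1"
    using d unfolding M_def by (simp_all add: real_nat_ceiling_ge of_nat_ceiling)
  have M1: "M \<ge> 1" using M(1) d by (cases M) (auto simp: field_simps)
  let ?C = "square M ` grid (M + 1)"
  let ?P = "\<lambda>n. \<exists>C. finite C \<and> card C = n \<and> F \<subseteq> \<Union> C \<and> (\<forall>U \<in> C. bounded U \<and> diameter U \<le> \<delta>)"
  have "2 / real M \<le> \<delta>" using M(1) M1 d by (simp add: field_simps)
  then have small: "diameter (square M s) \<le> \<delta>" for s using diameter_square_le[OF M1, of s] by linarith
  have P: "?P (card ?C)"
    using F unit_square_covered[OF M1] small
    by (intro exI[of _ ?C]) (auto simp: bounded_square grid_def)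
  have "box_number \<delta> F \<le> card ?C" unfolding box_number_def by (rule Least_le[of ?P, OF P])
  also have "\<dots> \<le> card (grid (M + 1))" by (rule card_image_le) (simp add: grid_def)
  also have "\<dots> = (M + 1)\<^sup>2" by (simp add: grid_def card_cartesian_product power2_eq_square)
  finally have "real (box_number \<delta> F) \<le> real ((M + 1)\<^sup>2)" by (simp only: of_nat_le_iff)
  also have "\<dots> = (real M + 1)\<^sup>2" by simp
  also have "\<dots> \<le> (4 / \<delta>)\<^sup>2"
  proof (rule power_mono)
    have "2 \<le> 2 / \<delta>" using d by (simp add: field_simps)
    then show "real M + 1 \<le> 4 / \<delta>" using M(2) by (simp add: field_simps)
  qed simp
  also have "\<dots> = 16 / \<delta>\<^sup>2" by (simp add: power_divide)
  finally show "real (box_number \<delta> F) \<le> 16 / \<delta>\<^sup>2" .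
  show "?P (box_number \<delta> F)" unfolding box_number_def by (rule LeastI[of ?P, OF P])
qed

lemma squares_met_le_box_number:
  assumes F: "F \<subseteq> square 1 (0, 0)" and d: "0 < \<delta>" "\<delta> < 1" and M: "M \<ge> 1" "\<delta> \<le> 1 / real M"
  shows "card (squares_met M F) \<le> 16 * box_number \<delta> F"
proof -
  obtain C where C: "finite C" "card C = box_number \<delta> F" "F \<subseteq> \<Union> C"
    "\<And>U. U \<in> C \<Longrightarrow> bounded U \<and> diameter U \<le> \<delta>"
    using box_number_cover(2)[OF F d] by blast
  have "squares_met M F \<subseteq> (\<Union>U\<in>C. squares_met M U)" using C(3) unfolding squares_met_def by blast
  then have "card (squares_met M F) \<le> card (\<Union>U\<in>C. squares_met M U)"
    by (intro card_mono finite_UN_I C(1) finite_squares_met)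
  also have "\<dots> \<le> (\<Sum>U\<in>C. card (squares_met M U))" by (rule card_UN_le[OF C(1)])
  also have "\<dots> \<le> (\<Sum>U\<in>C. 16)"
    using C(4) M by (intro sum_mono card_squares_met_small_set) force+
  finally show ?thesis using C(2) by simp
qed

section \<open>Factorial growth forces box dimension two\<close>

text \<open>
The crude Stirling bound \<open>n ^ n \<le> exp n * fact n\<close>: one term of the exponential series at \<open>n\<close> is at most
its sum.
\<close>

lemma ln_fact_lower_bound: "real n * ln (real n) - real n \<le> ln (fact n)"
proof (cases "n = 0")
  case False
  have "real n ^ n /\<^sub>R fact n \<le> exp (real n)"
  proof -
    have s: "(\<lambda>k. real n ^ k /\<^sub>R fact k) sums exp (real n)" by (rule exp_converges)
    have "(\<Sum>k\<in>{n}. real n ^ k /\<^sub>R fact k) \<le> (\<Sum>k. real n ^ k /\<^sub>R fact k)"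
      by (rule sum_le_suminf[OF sums_summable[OF s]]) auto
    also have "\<dots> = exp (real n)" by (rule sums_unique[OF s, symmetric])
    finally have "(\<Sum>k\<in>{n}. real n ^ k /\<^sub>R fact k) \<le> exp (real n)" .
    then show ?thesis by simp
  qed
  then have "real n ^ n \<le> exp (real n) * fact n" by (simp add: field_simps)
  then have "ln (real n ^ n) \<le> ln (exp (real n) * fact n)"
    using False by (intro ln_mono) auto
  then show ?thesis using False by (simp add: ln_mult ln_realpow)
qed simp

lemma over_ln_fact_tendsto_0: "(\<lambda>n. real n / ln (fact n)) \<longlonglongrightarrow> 0"
proof (rule tendsto_sandwich[where f = "\<lambda>_. 0"])
  have lim: "filterlim (\<lambda>n. ln (real n) - 1) at_top sequentially"
    by (rule filterlim_at_top_mono[OF filterlim_tendsto_add_at_top[OF tendsto_const[of "-1"]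
          filterlim_compose[OF ln_at_top filterlim_real_sequentially]]]) simp
  then show "(\<lambda>n. inverse (ln (real n) - 1)) \<longlonglongrightarrow> 0" by (rule tendsto_inverse_0_at_top)
  have "eventually (\<lambda>n. ln (real n) - 1 > 0) sequentially"
    using lim unfolding filterlim_at_top_dense by blast
  then show "\<forall>\<^sub>F n in sequentially. real n / ln (fact n) \<le> inverse (ln (real n) - 1)"
    using eventually_gt_at_top[of 0]
  proof eventually_elim
    case (elim n)
    have "0 < real n * (ln (real n) - 1)" using elim by simp
    moreover have "real n * (ln (real n) - 1) \<le> ln (fact n)"
      using ln_fact_lower_bound[of n] by (simp add: algebra_simps)
    ultimately have "real n / ln (fact n) \<le> real n / (real n * (ln (real n) - 1))"
      by (intro divide_left_mono mult_pos_pos[of "ln (fact n)"]) linarith+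
    also have "\<dots> = inverse (ln (real n) - 1)" using elim by (simp add: field_simps)
    finally show ?case .
  qed
  show "\<forall>\<^sub>F n in sequentially. 0 \<le> real n / ln (fact n)"
    by (simp add: ln_ge_zero fact_ge_1)
qed simp

lemma ln_fact_tendsto_at_top: "filterlim (\<lambda>n. ln (fact n) :: real) at_top sequentially"
proof (rule filterlim_at_top_mono)
  show "filterlim real at_top sequentially" by (rule filterlim_real_sequentially)
  have "eventually (\<lambda>n. real n / ln (fact n) < 1) sequentially"
    using over_ln_fact_tendsto_0 by (rule order_tendstoD) simp
  then show "\<forall>\<^sub>F n in sequentially. real n \<le> ln (fact n)"
    using eventually_ge_at_top[of 2]
  proof eventually_elim
    case (elim n)
    have "(fact n :: real) > 1" using elim(2) fact_less_mono[of 1 n, where ?'a = real] by simp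
    then have "0 < ln (fact n :: real)" by simp
    with elim(1) show ?case by (simp add: field_simps)
  qed
qed

lemma factorial_exponent_tendsto_2:
  fixes c L :: real
  shows "(\<lambda>n. (2 * ln (fact n) - c) / (real (n + 1) * L + ln (fact n))) \<longlonglongrightarrow> 2"
proof -
  let ?f = "\<lambda>n. ln (fact n) :: real"
  have i: "(\<lambda>n. inverse (?f n)) \<longlonglongrightarrow> 0"
    by (rule tendsto_inverse_0_at_top[OF ln_fact_tendsto_at_top])
  have "(\<lambda>n. (2 - c * inverse (?f n)) / ((real n / ?f n + inverse (?f n)) * L + 1))
      \<longlonglongrightarrow> (2 - c * 0) / ((0 + 0) * L + 1)"
    by (intro tendsto_intros i over_ln_fact_tendsto_0) simp
  moreover have "\<forall>\<^sub>F n in sequentially. (2 - c * inverse (?f n)) / ((real n / ?f n + inverse (?f n)) * L + 1)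
      = (2 * ?f n - c) / (real (n + 1) * L + ?f n)"
  proof -
    have "\<forall>\<^sub>F n in sequentially. ?f n > 0"
      using ln_fact_tendsto_at_top unfolding filterlim_at_top_dense by blast
    then show ?thesis
    proof eventually_elim
      case (elim n)
      have "2 * ?f n - c = ?f n * (2 - c * inverse (?f n))"
        "real (n + 1) * L + ?f n = ?f n * ((real n / ?f n + inverse (?f n)) * L + 1)"
        using elim by (simp_all add: field_simps)
      then show ?case using elim by simp
    qed
  qed
  ultimately show ?thesis by (auto intro: Lim_transform_eventually)
qed

text \<open>
For a given \<open>\<delta>\<close> the level \<open>N \<delta>\<close> is chosen maximal such that \<open>g (N \<delta>) \<le> 1 / \<delta>\<close>, where \<open>g n = 11 ^ n * fact n\<close>
bounds the widths.  The grid of level \<open>N \<delta>\<close> then has mesh at least \<open>\<delta>\<close>, so that its squares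
can be compared with covers by sets of diameter \<open>\<delta>\<close>, while \<open>- ln \<delta>\<close> is at most \<open>ln (g (N \<delta> + 1))\<close>.  Passing
from one level to the next costs only a logarithmic term, so the quotient is bounded below by a sequence
that tends to 2.
\<close>

lemma box_dimension_2I:
  fixes W :: "nat \<Rightarrow> nat"
  assumes F: "F \<subseteq> square 1 (0, 0)"
    and W: "\<And>n. W n \<ge> 1" "\<And>n. W n \<le> 11 ^ n * fact n"
    and c: "c \<ge> 1" and many: "\<And>n. n \<ge> d \<Longrightarrow> (fact n)\<^sup>2 \<le> card (squares_met (W n) F) * (c::nat)"
  shows "has_box_dimension F 2"
proof -
  define g :: "nat \<Rightarrow> nat" where "g n = 11 ^ n * fact n" for n
  define N where "N \<delta> = Max {n. real (g n) \<le> 1 / \<delta>}" for \<delta> :: real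
  have g_ge: "n \<le> g n" for n
  proof -
    have "n \<le> 11 ^ n" using self_le_ge2_pow[of 11 n] by simp
    also have "\<dots> \<le> g n" unfolding g_def using fact_ge_1[of n, where ?'a = nat] by simp
    finally show ?thesis .
  qed
  have g_mono: "g i \<le> g k" if "i \<le> k" for i k
    unfolding g_def using that by (intro mult_le_mono power_increasing fact_mono) auto
  have g_pos: "g n \<ge> 1" for n unfolding g_def using fact_ge_1[of n, where ?'a = nat] by simp
  have fin: "finite {n. real (g n) \<le> 1 / \<delta>}" for \<delta>
  proof (rule finite_subset)
    show "{n. real (g n) \<le> 1 / \<delta>} \<subseteq> {..nat \<lceil>1 / \<delta>\<rceil>}"
    proof
      fix n assume "n \<in> {n. real (g n) \<le> 1 / \<delta>}"
      then have "real n \<le> 1 / \<delta>" using g_ge[of n] by simp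
      then show "n \<in> {..nat \<lceil>1 / \<delta>\<rceil>}" by simp linarith
    qed
  qed simp
  have N: "real (g (N \<delta>)) \<le> 1 / \<delta>" "1 / \<delta> < real (g (Suc (N \<delta>)))" if "0 < \<delta>" "\<delta> < 1" for \<delta>
  proof -
    have "0 \<in> {n. real (g n) \<le> 1 / \<delta>}" using that by (simp add: g_def)
    then have "N \<delta> \<in> {n. real (g n) \<le> 1 / \<delta>}" unfolding N_def by (intro Max_in fin) blast
    then show "real (g (N \<delta>)) \<le> 1 / \<delta>" by simp
    show "1 / \<delta> < real (g (Suc (N \<delta>)))"
    proof (rule ccontr)
      assume "\<not> ?thesis"
      then have "Suc (N \<delta>) \<le> N \<delta>" unfolding N_def by (intro Max_ge fin) (simp add: not_less)
      then show False by simp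
    qed
  qed
  have small: "eventually (\<lambda>\<delta>. \<delta> < e) (at_right (0::real))" if "e > 0" for e
    using eventually_at_right_less that by (auto simp: eventually_at_right_field)
  have pos: "eventually (\<lambda>\<delta>. 0 < \<delta>) (at_right (0::real))" by (simp add: eventually_at_right_less)
  have N_lim: "filterlim N at_top (at_right 0)"
    unfolding filterlim_at_top
  proof
    fix k
    have "eventually (\<lambda>\<delta>. \<delta> < 1 / real (g k)) (at_right 0)" using g_pos[of k] by (intro small) simp
    then show "eventually (\<lambda>\<delta>. k \<le> N \<delta>) (at_right 0)" using pos
    proof eventually_elim
      case (elim \<delta>)
      have "real (g k) > 0" using g_pos[of k] by simp
      then have "real (g k) \<le> 1 / \<delta>" using elim by (simp add: field_simps)
      then show ?case unfolding N_def by (intro Max_ge fin) simp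
    qed
  qed
  define C where "C = ln (16 * real c)"
  define h where "h n = (2 * ln (fact n) - C) / (real (n + 1) * (ln 11 + 1) + ln (fact n))" for n
  have h: "h \<longlonglongrightarrow> 2" unfolding h_def by (rule factorial_exponent_tendsto_2)
  have h_lim: "((\<lambda>\<delta>. h (N \<delta>)) \<longlongrightarrow> 2) (at_right 0)" by (rule filterlim_compose[OF h N_lim])
  have upper_lim: "((\<lambda>\<delta>. ln 16 * inverse (- ln \<delta>) + 2) \<longlongrightarrow> ln 16 * 0 + 2) (at_right (0::real))"
  proof (intro tendsto_intros tendsto_inverse_0_at_top)
    show "filterlim (\<lambda>\<delta>::real. - ln \<delta>) at_top (at_right 0)"
      using ln_at_0 by (simp add: filterlim_uminus_at_top)
  qed
  have "eventually (\<lambda>n. 2 * ln (fact n) - C \<ge> 0) sequentially"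
  proof -
    have "eventually (\<lambda>n. ln (fact n) \<ge> C / 2) sequentially"
      using ln_fact_tendsto_at_top unfolding filterlim_at_top by blast
    then show ?thesis by eventually_elim simp
  qed
  then have num: "eventually (\<lambda>\<delta>. 2 * ln (fact (N \<delta>)) - C \<ge> 0) (at_right 0)"
    using N_lim by (rule eventually_compose_filterlim)
  have deep: "eventually (\<lambda>\<delta>. d \<le> N \<delta>) (at_right 0)" using N_lim by (auto simp: filterlim_at_top)
  have box_pos: "real (box_number \<delta> F) \<ge> (fact (N \<delta>))\<^sup>2 / (16 * real c)"
    if "0 < \<delta>" "\<delta> < 1" "d \<le> N \<delta>" for \<delta>
  proof -
    have "real (W (N \<delta>)) \<le> real (g (N \<delta>))" using W(2)[of "N \<delta>"] unfolding g_def by (simp only: of_nat_le_iff)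
    also have "\<dots> \<le> 1 / \<delta>" using N(1) that by simp
    finally have "\<delta> \<le> 1 / real (W (N \<delta>))" using W(1)[of "N \<delta>"] that by (simp add: field_simps)
    then have "card (squares_met (W (N \<delta>)) F) \<le> 16 * box_number \<delta> F"
      using that W(1) by (intro squares_met_le_box_number[OF F])
    then have "(fact (N \<delta>))\<^sup>2 \<le> 16 * box_number \<delta> F * c"
      using many[OF that(3)] by (meson le_trans mult_le_mono1)
    then have "real ((fact (N \<delta>))\<^sup>2) \<le> real (16 * box_number \<delta> F * c)" by (simp only: of_nat_le_iff)
    then show ?thesis using c by (simp add: field_simps)
  qed
  have "((\<lambda>\<delta>. ln (real (box_number \<delta> F)) / - ln \<delta>) \<longlongrightarrow> 2) (at_right 0)"
  proof (rule tendsto_sandwich)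
    show "((\<lambda>\<delta>. h (N \<delta>)) \<longlongrightarrow> 2) (at_right 0)" by (rule h_lim)
    show "((\<lambda>\<delta>. ln 16 * inverse (- ln \<delta>) + 2) \<longlongrightarrow> 2) (at_right (0::real))" using upper_lim by simp
    show "\<forall>\<^sub>F \<delta> in at_right 0. h (N \<delta>) \<le> ln (real (box_number \<delta> F)) / - ln \<delta>"
      using pos small[of 1, simplified] deep num
    proof eventually_elim
      case (elim \<delta>)
      let ?n = "N \<delta>"
      have fpos: "(0::real) < (fact ?n)\<^sup>2 / (16 * real c)" using c by simp
      have "ln ((fact ?n)\<^sup>2 / (16 * real c)) \<le> ln (real (box_number \<delta> F))"
        using box_pos[OF elim(1,2,3)] fpos by (intro ln_mono) auto
      moreover have "ln ((fact ?n)\<^sup>2 / (16 * real c)) = 2 * ln (fact ?n) - C"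
        using c unfolding C_def by (simp add: ln_div ln_realpow)
      ultimately have lb: "2 * ln (fact ?n) - C \<le> ln (real (box_number \<delta> F))" by simp
      have "- ln \<delta> = ln (1 / \<delta>)" using elim by (simp add: ln_div)
      also have "\<dots> \<le> ln (real (g (Suc ?n)))"
        using N(2)[OF elim(1,2)] elim by (intro ln_mono) (auto intro: less_imp_le)
      also have "real (g (Suc ?n)) = 11 ^ Suc ?n * (real (Suc ?n) * fact ?n)" by (simp add: g_def algebra_simps)
      also have "ln \<dots> = real (Suc ?n) * ln 11 + (ln (real (Suc ?n)) + ln (fact ?n))"
        by (simp add: ln_mult ln_realpow del: power_Suc of_nat_Suc)
      \<comment> \<open>The term \<open>ln (n + 1) \<le> n\<close> is absorbed by the summand 1 next to \<open>ln 11\<close>.\<close>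
      also have "\<dots> \<le> real (?n + 1) * (ln 11 + 1) + ln (fact ?n)"
        using ln_le_minus_one[of "real (Suc ?n)"] by (simp add: algebra_simps)
      finally have ub: "- ln \<delta> \<le> real (?n + 1) * (ln 11 + 1) + ln (fact ?n)" .
      have neg: "0 < - ln \<delta>" using elim by simp
      have "h ?n \<le> (2 * ln (fact ?n) - C) / - ln \<delta>"
        unfolding h_def using elim(4) ub neg by (intro divide_left_mono mult_pos_pos) linarith+
      also have "\<dots> \<le> ln (real (box_number \<delta> F)) / - ln \<delta>"
        using lb neg by (intro divide_right_mono) linarith+
      finally show ?case .
    qed
    show "\<forall>\<^sub>F \<delta> in at_right 0. ln (real (box_number \<delta> F)) / - ln \<delta> \<le> ln 16 * inverse (- ln \<delta>) + 2"
      using pos small[of 1, simplified] deep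
    proof eventually_elim
      case (elim \<delta>)
      have neg: "0 < - ln \<delta>" using elim by simp
      have fpos: "(0::real) < (fact (N \<delta>))\<^sup>2 / (16 * real c)" using c by simp
      have "0 < real (box_number \<delta> F)" using box_pos[OF elim] fpos by linarith
      then have "ln (real (box_number \<delta> F)) \<le> ln (16 / \<delta>\<^sup>2)"
        using box_number_cover(1)[OF F elim(1,2)] by (intro ln_mono) auto
      also have "\<dots> = ln 16 + 2 * (- ln \<delta>)" using elim by (simp add: ln_div ln_realpow)
      finally have "ln (real (box_number \<delta> F)) / - ln \<delta> \<le> (ln 16 + 2 * (- ln \<delta>)) / - ln \<delta>"
        using neg by (intro divide_right_mono) linarith+
      also have "\<dots> = ln 16 * inverse (- ln \<delta>) + 2" using neg by (simp add: field_simps)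
      finally show ?case .
    qed
  qed
  moreover have "F \<noteq> {}"
  proof
    assume "F = {}"
    then have "(fact d :: nat)\<^sup>2 \<le> 0" using many[of d] by (simp add: squares_met_def)
    then show False by simp
  qed
  moreover have "bounded F" using F bounded_square bounded_subset by blast
  ultimately show ?thesis unfolding has_box_dimension_def by blast
qed

section \<open>Fractals with snake cross cores\<close>

lemma snake_width_prod_le:
  assumes "\<And>k. k \<ge> 1 \<Longrightarrow> m k = 4 * k + 7"
  shows "width_prod m n \<le> 11 ^ n * fact n"
proof (induction n)
  case (Suc n)
  have "width_prod m (Suc n) = width_prod m n * m (Suc n)" by (simp add: width_prod_def)
  also have "m (Suc n) \<le> 11 * Suc n" using assms[of "Suc n"] by simp
  then have "width_prod m n * m (Suc n) \<le> (11 ^ n * fact n) * (11 * Suc n)"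
    using Suc by (intro mult_le_mono)
  also have "\<dots> = 11 ^ Suc n * fact (Suc n)" by (simp add: algebra_simps)
  finally show ?case .
qed (simp add: width_prod_def)

theorem corollary3:
  fixes m :: "nat \<Rightarrow> nat" and A :: "nat \<Rightarrow> (nat \<times> nat) set"
  assumes "\<And>k. k \<ge> 1 \<Longrightarrow> labyrinth_pattern (m k) (A k)"
    and "\<And>k. k \<ge> 1 \<Longrightarrow> core (m k) (A k) = snake_cross k"
  shows "has_box_dimension (limit_set m A) 2 \<and>
    (\<forall>a b \<gamma>. a \<in> limit_set m A \<and> b \<in> limit_set m A \<and> a \<noteq> b \<and>
       arc \<gamma> \<and> path_image \<gamma> \<subseteq> limit_set m A \<and> pathstart \<gamma> = a \<and> pathfinish \<gamma> = b \<longrightarrow>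
       has_box_dimension (path_image \<gamma>) 2)"
proof -
  interpret snake_sequence 0 m A
    by unfold_locales (use assms in simp_all)
  have "m k = 4 * k + 7" if "k \<ge> 1" for k
    using core_eq_snake_cross_imp_width[OF assms(1)[OF that] assms(2)[OF that]] .
  then have W: "width_prod m n \<ge> 1" "width_prod m n \<le> 11 ^ n * fact n" for n
    using width_prod_ge_1[of m n] width_ge_1 snake_width_prod_le by auto
  have dim: "has_box_dimension F 2"
    if F: "F \<subseteq> limit_set m A" and many: "meets_factorially_many 0 m d F" for F d
  proof (rule box_dimension_2I[where W = "width_prod m" and c = "(fact d)\<^sup>2" and d = d])
    show "F \<subseteq> square 1 (0, 0)" using F limit_set_subset_unit_square by blast
    show "(fact d :: nat)\<^sup>2 \<ge> 1" by (simp add: fact_ge_1)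
    show "(fact n)\<^sup>2 \<le> card (squares_met (width_prod m n) F) * (fact d :: nat)\<^sup>2" if "d \<le> n" for n
      using many that unfolding meets_factorially_many_def by simp
  qed (use W in blast)+
  have "meets_factorially_many 0 m 0 (limit_set m A)"
    using limit_meets_factorially_many[OF snake_sequence_axioms] by (simp add: meets_factorially_many_def)
  then have "has_box_dimension (limit_set m A) 2" by (intro dim) auto
  moreover have "has_box_dimension (path_image \<gamma>) 2"
    if ab: "a \<noteq> b" and g: "arc \<gamma>" "path_image \<gamma> \<subseteq> limit_set m A" "pathstart \<gamma> = a" "pathfinish \<gamma> = b" for a b \<gamma>
  proof -
    have con: "connected (path_image \<gamma>)" using g(1) by (intro connected_path_image arc_imp_path)
    have "a \<in> path_image \<gamma>" "b \<in> path_image \<gamma>" using g by auto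
    then obtain d where "meets_factorially_many 0 m d (path_image \<gamma>)"
      using dist_power_unbounded[OF ab] connected_two_points[OF snake_sequence_axioms con g(2)] by blast
    then show ?thesis by (rule dim[OF g(2)])
  qed
  ultimately show ?thesis by blast
qed

end
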